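(* The group $(\delta+\mathbb{K}^m_{LC}\langle\langle X\rangle\rangle,\circ,\delta)$ is an analytic Lie group with respect to the Silva topology.
   Context: $\mathbb{K}\in\{\mathbb{R},\mathbb{C}\}$. $X=\{x_0,x_1,\ldots,x_m\}$ is a finite alphabet, $X^\ast$ its words (including $\emptyset$), $|\eta|$ the length. $\mathbb{K}^m\langle\langle X\rangle\rangle$ is the space of maps $X^\ast\to\mathbb{K}^m$. For $M>0$, $\|c\|_{\ell_\infty,M}=\sup_\eta|(c,\eta)|/(M^{|\eta|}|\eta|!)$ ($|z|=\max_i|z_i|$), $\ell_{\infty,M}(X^\ast,\mathbb{K}^m)$ the Banach space of series with finite norm, and $\mathbb{K}^m_{LC}\langle\langle X\rangle\rangle=\bigcup_{M>0}\ell_{\infty,M}(X^\ast,\mathbb{K}^m)$ with the Silva topology (locally convex inductive limit). $\delta$ is a formal symbol (the generating series of the identity operator), and $\delta+\mathbb{K}^m_{LC}\langle\langle X\rangle\rangle=\{c_\delta:=\delta+c\}$ is identified with $\mathbb{K}^m_{LC}\langle\langle X\rangle\rangle$ as a manifold (an affine space). The shuffle product $\sqcup\!\sqcup$ is determined on words by $(x_i\eta)\sqcup\!\sqcup(x_j\xi)=x_i(\eta\sqcup\!\sqcup(x_j\xi))+x_j((x_i\eta)\sqcup\!\sqcup\xi)$, $\eta\sqcup\!\sqcup\emptyset=\emptyset\sqcup\!\sqcup\eta=\eta$. Mixed composition: for $d$ with components $d[1],\ldots,d[m]$ and $d[0]:=0$, let $\phi_d(\emptyset)=\mathrm{id}$,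 $\phi_d(x_i\eta)=\phi_d(x_i)\circ\phi_d(\eta)$, $\phi_d(x_i)(e)=x_ie+x_0(d[i]\sqcup\!\sqcup e)$, and $c\,\tilde\circ\,d_\delta=\sum_\eta(c,\eta)\phi_d(\eta)(\mathbf{1})$ with $\mathbf{1}=1\cdot\emptyset$. The group product is $c_\delta\circ d_\delta=\delta+d+c\,\tilde\circ\,d_\delta$, with identity $\delta$; this makes $\delta+\mathbb{K}^m_{LC}\langle\langle X\rangle\rangle$ a group. An analytic Lie group is a group with an analytic manifold structure making multiplication and inversion analytic, where analyticity is in the Bastiani sense (complex analytic = continuous with continuous iterated directional derivatives of all orders over $\mathbb{C}$; real analytic = extends to a complex analytic map on an open neighbourhood in the complexification). *)

theory Defs
  imports "HOL-Analysis.Analysis" "HOL-Library.Function_Algebras" "HOL-Library.Product_Plus"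
          "HOL-Algebra.Group"
begin

text \<open>Words are lists of letter indices (letter i stands for x_i).
  A K^m-valued series is a map from words to K^m; we represent K^m by maps
  nat => K that vanish outside the component indices 1..m.\<close>

type_synonym 'k ser = "nat list \<Rightarrow> nat \<Rightarrow> 'k"

definition wf_ser :: "nat \<Rightarrow> 'k::zero ser \<Rightarrow> bool" where
  "wf_ser m c \<longleftrightarrow> (\<forall>\<eta> i. (\<not> set \<eta> \<subseteq> {0..m} \<or> i \<notin> {1..m}) \<longrightarrow> c \<eta> i = 0)"

definition bounded_M :: "real \<Rightarrow> 'k::real_normed_field ser \<Rightarrow> bool" where
  "bounded_M M c \<longleftrightarrow> (\<exists>B. \<forall>\<eta> i. norm (c \<eta> i) \<le> B * M ^ length \<eta> * fact (length \<eta>))"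

definition LC :: "nat \<Rightarrow> 'k::real_normed_field ser set" where
  "LC m = {c. wf_ser m c \<and> (\<exists>M>0. bounded_M M c)}"

definition absconv :: "'k::real_normed_field ser set \<Rightarrow> bool" where
  "absconv V \<longleftrightarrow> (\<forall>a\<in>V. \<forall>b\<in>V. \<forall>s t::'k. norm s + norm t \<le> 1 \<longrightarrow>
      (\<lambda>\<eta> i. s * a \<eta> i + t * b \<eta> i) \<in> V)"

text \<open>0-neighbourhoods of the locally convex inductive limit (Silva) topology:
  absolutely convex sets whose trace on every l_{infty,M} contains a norm ball.\<close>
definition silva_nbhd0 :: "nat \<Rightarrow> 'k::real_normed_field ser set \<Rightarrow> bool" where
  "silva_nbhd0 m V \<longleftrightarrow> V \<subseteq> LC m \<and> absconv V \<and>
     (\<forall>M>0. \<exists>\<epsilon>>0. \<forall>c. wf_ser m c \<and>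
        (\<forall>\<eta> i. norm (c \<eta> i) \<le> \<epsilon> * M ^ length \<eta> * fact (length \<eta>)) \<longrightarrow> c \<in> V)"

definition silva_open :: "nat \<Rightarrow> 'k::real_normed_field ser set \<Rightarrow> bool" where
  "silva_open m U \<longleftrightarrow> U \<subseteq> LC m \<and>
     (\<forall>x\<in>U. \<exists>V. silva_nbhd0 m V \<and> (\<lambda>v. x + v) ` V \<subseteq> U)"

lemma istopology_silva_open: "istopology (silva_open m)"
  unfolding istopology_def
proof (intro conjI allI impI)
  fix S T :: "'a::real_normed_field ser set"
  assume S: "silva_open m S" and T: "silva_open m T"
  show "silva_open m (S \<inter> T)"
    unfolding silva_open_def
  proof (intro conjI ballI)
    show "S \<inter> T \<subseteq> LC m" using S unfolding silva_open_def by blast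
  next
    fix x assume x: "x \<in> S \<inter> T"
    obtain V1 where V1: "silva_nbhd0 m V1" "(\<lambda>v. x + v) ` V1 \<subseteq> S"
      using S x unfolding silva_open_def by blast
    obtain V2 where V2: "silva_nbhd0 m V2" "(\<lambda>v. x + v) ` V2 \<subseteq> T"
      using T x unfolding silva_open_def by blast
    have "silva_nbhd0 m (V1 \<inter> V2)"
      unfolding silva_nbhd0_def
    proof (intro conjI allI impI)
      show "V1 \<inter> V2 \<subseteq> LC m" using V1 unfolding silva_nbhd0_def by blast
      show "absconv (V1 \<inter> V2)" using V1(1) V2(1)
        unfolding silva_nbhd0_def absconv_def by blast
    next
      fix M :: real assume M: "M > 0"
      obtain e1 where e1: "e1 > 0" "\<forall>c. wf_ser m c \<and>
        (\<forall>\<eta> i. norm (c \<eta> i) \<le> e1 * M ^ length \<eta> * fact (length \<eta>)) \<longrightarrow> c \<in> V1"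
        using V1(1) M unfolding silva_nbhd0_def by blast
      obtain e2 where e2: "e2 > 0" "\<forall>c. wf_ser m c \<and>
        (\<forall>\<eta> i. norm (c \<eta> i) \<le> e2 * M ^ length \<eta> * fact (length \<eta>)) \<longrightarrow> c \<in> V2"
        using V2(1) M unfolding silva_nbhd0_def by blast
      show "\<exists>\<epsilon>>0. \<forall>c. wf_ser m c \<and>
        (\<forall>\<eta> i. norm (c \<eta> i) \<le> \<epsilon> * M ^ length \<eta> * fact (length \<eta>)) \<longrightarrow> c \<in> V1 \<inter> V2"
      proof (intro exI[of _ "min e1 e2"] conjI allI impI)
        show "min e1 e2 > 0" using e1 e2 by simp
      next
        fix c :: "'a ser"
        assume c: "wf_ser m c \<and> (\<forall>\<eta> i. norm (c \<eta> i) \<le> min e1 e2 * M ^ length \<eta> * fact (length \<eta>))"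
        have pos: "0 \<le> M ^ length \<eta> * fact (length \<eta>)" for \<eta> :: "nat list"
          using M by simp
        have "norm (c \<eta> i) \<le> e1 * M ^ length \<eta> * fact (length \<eta>)" for \<eta> i
        proof -
          have "min e1 e2 * (M ^ length \<eta> * fact (length \<eta>)) \<le> e1 * (M ^ length \<eta> * fact (length \<eta>))"
            using pos[of \<eta>] by (intro mult_right_mono) auto
          then show ?thesis using c by (simp add: mult.assoc) (meson order_trans)
        qed
        moreover have "norm (c \<eta> i) \<le> e2 * M ^ length \<eta> * fact (length \<eta>)" for \<eta> i
        proof -
          have "min e1 e2 * (M ^ length \<eta> * fact (length \<eta>)) \<le> e2 * (M ^ length \<eta> * fact (length \<eta>))"
            using pos[of \<eta>] by (intro mult_right_mono) auto
          then show ?thesis using c by (simp add: mult.assoc) (meson order_trans)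
        qed
        ultimately show "c \<in> V1 \<inter> V2" using c e1 e2 by blast
      qed
    qed
    moreover have "(\<lambda>v. x + v) ` (V1 \<inter> V2) \<subseteq> S \<inter> T" using V1 V2 by blast
    ultimately show "\<exists>V. silva_nbhd0 m V \<and> (\<lambda>v. x + v) ` V \<subseteq> S \<inter> T" by blast
  qed
next
  fix K :: "'a::real_normed_field ser set set"
  assume K: "\<forall>U\<in>K. silva_open m U"
  show "silva_open m (\<Union>K)"
    unfolding silva_open_def
  proof (intro conjI ballI)
    show "\<Union>K \<subseteq> LC m" using K unfolding silva_open_def by blast
  next
    fix x assume "x \<in> \<Union>K"
    then obtain U where U: "U \<in> K" "x \<in> U" by blast
    then obtain V where "silva_nbhd0 m V" "(\<lambda>v. x + v) ` V \<subseteq> U"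
      using K unfolding silva_open_def by blast
    then show "\<exists>V. silva_nbhd0 m V \<and> (\<lambda>v. x + v) ` V \<subseteq> \<Union>K" using U by blast
  qed
qed

definition silva_top :: "nat \<Rightarrow> 'k::real_normed_field ser topology" where
  "silva_top m = topology (silva_open m)"

text \<open>shc eta xi nu = coefficient of the word nu in eta shuffle xi\<close>
fun shc :: "nat list \<Rightarrow> nat list \<Rightarrow> nat list \<Rightarrow> nat" where
  "shc [] \<xi> \<nu> = (if \<nu> = \<xi> then 1 else 0)"
| "shc (a # \<eta>) [] \<nu> = (if \<nu> = a # \<eta> then 1 else 0)"
| "shc (a # \<eta>) (b # \<xi>) [] = 0"
| "shc (a # \<eta>) (b # \<xi>) (c # \<nu>) =
     (if c = a then shc \<eta> (b # \<xi>) \<nu> else 0) + (if c = b then shc (a # \<eta>) \<xi> \<nu> else 0)"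

definition shuffle :: "(nat list \<Rightarrow> 'k::comm_ring_1) \<Rightarrow> (nat list \<Rightarrow> 'k) \<Rightarrow> nat list \<Rightarrow> 'k" where
  "shuffle a b \<nu> = (\<Sum>(\<eta>, \<xi>) \<in> {(\<eta>, \<xi>). \<eta> \<in> set (subseqs \<nu>) \<and> \<xi> \<in> set (subseqs \<nu>) \<and>
       length \<eta> + length \<xi> = length \<nu>}. a \<eta> * b \<xi> * of_nat (shc \<eta> \<xi> \<nu>))"

definition lcat :: "nat \<Rightarrow> (nat list \<Rightarrow> 'k::zero) \<Rightarrow> nat list \<Rightarrow> 'k" where
  "lcat j e \<nu> = (case \<nu> of [] \<Rightarrow> 0 | a # \<nu>' \<Rightarrow> if a = j then e \<nu>' else 0)"

text \<open>phi_d(x_i)(e) = x_i e + x_0 (d[i] shuffle e), with d[0] = 0\<close>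
definition phi1 :: "'k::comm_ring_1 ser \<Rightarrow> nat \<Rightarrow> (nat list \<Rightarrow> 'k) \<Rightarrow> nat list \<Rightarrow> 'k" where
  "phi1 d i e = (\<lambda>\<nu>. lcat i e \<nu> +
      (if i = 0 then 0 else lcat 0 (shuffle (\<lambda>\<eta>. d \<eta> i) e) \<nu>))"

fun phi :: "'k::comm_ring_1 ser \<Rightarrow> nat list \<Rightarrow> (nat list \<Rightarrow> 'k) \<Rightarrow> nat list \<Rightarrow> 'k" where
  "phi d [] e = e"
| "phi d (i # \<eta>) e = phi1 d i (phi d \<eta> e)"

definition one_ser :: "nat list \<Rightarrow> 'k::{zero,one}" where
  "one_ser \<nu> = (if \<nu> = [] then 1 else 0)"

text \<open>mixed composition c ~o d_delta; only words eta with |eta| <= |nu| contribute to the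
  coefficient of nu\<close>
definition mixed_comp :: "nat \<Rightarrow> 'k::comm_ring_1 ser \<Rightarrow> 'k ser \<Rightarrow> 'k ser" where
  "mixed_comp m c d = (\<lambda>\<nu> k. \<Sum>\<eta> \<in> {\<eta>. set \<eta> \<subseteq> {0..m} \<and> length \<eta> \<le> length \<nu>}.
       c \<eta> k * phi d \<eta> one_ser \<nu>)"

text \<open>group product (delta + c) o (delta + d) = delta + d + c ~o d_delta, in the
  affine chart c_delta = delta + c  <->  c\<close>
definition gmult :: "nat \<Rightarrow> 'k::comm_ring_1 ser \<Rightarrow> 'k ser \<Rightarrow> 'k ser" where
  "gmult m c d = d + mixed_comp m c d"

definition Fliess_group :: "nat \<Rightarrow> 'k::real_normed_field ser monoid" where
  "Fliess_group m = \<lparr>carrier = LC m, mult = gmult m, one = 0\<rparr>"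

fun bderiv :: "('k::real_normed_field \<Rightarrow> 'v::ab_group_add \<Rightarrow> 'v) \<Rightarrow> ('k \<Rightarrow> 'w::ab_group_add \<Rightarrow> 'w)
    \<Rightarrow> 'w topology \<Rightarrow> ('v \<Rightarrow> 'w) \<Rightarrow> nat \<Rightarrow> 'v \<Rightarrow> (nat \<Rightarrow> 'v) \<Rightarrow> 'w" where
  "bderiv sv sw Y f 0 x hs = f x"
| "bderiv sv sw Y f (Suc k) x hs =
     (THE l. limitin Y (\<lambda>t. sw (inverse t) (bderiv sv sw Y f k (x + sv t (hs k)) hs
                                 - bderiv sv sw Y f k x hs)) l (at 0))"

definition bastiani_smooth :: "('k::real_normed_field \<Rightarrow> 'v::ab_group_add \<Rightarrow> 'v) \<Rightarrow> ('k \<Rightarrow> 'w::ab_group_add \<Rightarrow> 'w)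
    \<Rightarrow> 'v topology \<Rightarrow> 'w topology \<Rightarrow> 'v set \<Rightarrow> ('v \<Rightarrow> 'w) \<Rightarrow> bool" where
  "bastiani_smooth sv sw X Y U f \<longleftrightarrow> openin X U \<and>
     (\<forall>k. \<forall>x\<in>U. \<forall>hs\<in>PiE {..<Suc k} (\<lambda>_. topspace X). \<exists>l.
        limitin Y (\<lambda>t. sw (inverse t) (bderiv sv sw Y f k (x + sv t (hs k)) hs
                                 - bderiv sv sw Y f k x hs)) l (at 0)) \<and>
     (\<forall>k. continuous_map
        (subtopology (prod_topology X (product_topology (\<lambda>_. X) {..<k}))
                     (U \<times> PiE {..<k} (\<lambda>_. topspace X)))
        Y (\<lambda>(x, hs). bderiv sv sw Y f k x hs))"

definition complex_analytic_B :: "(complex \<Rightarrow> 'v::ab_group_add \<Rightarrow> 'v) \<Rightarrow> (complex \<Rightarrow> 'w::ab_group_add \<Rightarrow> 'w)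
    \<Rightarrow> 'v topology \<Rightarrow> 'w topology \<Rightarrow> 'v set \<Rightarrow> ('v \<Rightarrow> 'w) \<Rightarrow> bool" where
  "complex_analytic_B = bastiani_smooth"

text \<open>real analytic: f maps the open set U into F and extends to a complex analytic map on an
  open neighbourhood of (the image of) U in the complexification.
  iE, iF: embeddings of the real spaces into their complexifications.\<close>
definition real_analytic_B ::
   "'v topology \<Rightarrow> 'w topology \<Rightarrow> 'vc topology \<Rightarrow> 'wc topology
    \<Rightarrow> (complex \<Rightarrow> 'vc::ab_group_add \<Rightarrow> 'vc) \<Rightarrow> (complex \<Rightarrow> 'wc::ab_group_add \<Rightarrow> 'wc)
    \<Rightarrow> ('v \<Rightarrow> 'vc) \<Rightarrow> ('w \<Rightarrow> 'wc) \<Rightarrow> 'v set \<Rightarrow> ('v \<Rightarrow> 'w) \<Rightarrow> bool" where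
  "real_analytic_B X Y XC YC svc swc iE iF U f \<longleftrightarrow> openin X U \<and> f ` U \<subseteq> topspace Y \<and>
     (\<exists>V g. openin XC V \<and> iE ` U \<subseteq> V \<and> complex_analytic_B svc swc XC YC V g \<and>
            (\<forall>x\<in>U. g (iE x) = iF (f x)))"

definition ser_scale :: "'k \<Rightarrow> 'k::times ser \<Rightarrow> 'k ser" where
  "ser_scale a c = (\<lambda>\<eta> i. a * c \<eta> i)"

definition pair_scale :: "'k \<Rightarrow> 'k::times ser \<times> 'k ser \<Rightarrow> 'k ser \<times> 'k ser" where
  "pair_scale a p = (ser_scale a (fst p), ser_scale a (snd p))"

definition cplx :: "real ser \<Rightarrow> complex ser" where
  "cplx c = (\<lambda>\<eta> i. complex_of_real (c \<eta> i))"

text \<open>Analytic Lie group (complex case) for the group with global affine chart c_delta <-> c.\<close>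
definition complex_analytic_Lie_group :: "nat \<Rightarrow> bool" where
  "complex_analytic_Lie_group m \<longleftrightarrow>
     group (Fliess_group m :: complex ser monoid) \<and>
     complex_analytic_B pair_scale ser_scale (prod_topology (silva_top m) (silva_top m)) (silva_top m)
        (LC m \<times> LC m) (\<lambda>(c, d). gmult m c d) \<and>
     complex_analytic_B ser_scale ser_scale (silva_top m) (silva_top m)
        (LC m) (m_inv (Fliess_group m))"

definition real_analytic_Lie_group :: "nat \<Rightarrow> bool" where
  "real_analytic_Lie_group m \<longleftrightarrow>
     group (Fliess_group m :: real ser monoid) \<and>
     real_analytic_B (prod_topology (silva_top m) (silva_top m)) (silva_top m)
        (prod_topology (silva_top m) (silva_top m)) (silva_top m) pair_scale ser_scale
        (\<lambda>(c, d). (cplx c, cplx d)) cplx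
        (LC m \<times> LC m) (\<lambda>(c, d). gmult m c d) \<and>
     real_analytic_B (silva_top m) (silva_top m) (silva_top m) (silva_top m) ser_scale ser_scale
        cplx cplx (LC m) (m_inv (Fliess_group m))"

end

theory Submission
  imports Defs "HOL-Complex_Analysis.Cauchy_Integral_Formula"
begin

text \<open>The left shifts are derivations of the shuffle product, so the algebraic identities behind
  the group structure follow by induction on words. For the estimates, the coefficients of a word of
  length \<open>n\<close> are majorized by those of \<open>(1 - L z) powr (- 1/2)\<close>, that is by
  \<open>pochhammer (1/2) n * L ^ n\<close>; this family is stable under the composition and under the fixed
  point equation \<open>d = - c \<circ> d\<close> of the inverse, so both operations map norm balls into
  norm balls. Every coefficient of the product and of the inverse is a polynomial in finitely many
  coefficients of the arguments. Maps of this kind are continuous, because the norm balls are compact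
  for coefficientwise convergence and the Silva topology is determined by its traces on them, and by
  the Cauchy estimates their directional derivatives are again of this kind.\<close>

section \<open>Shuffle product and mixed composition\<close>

text \<open>The estimates live on one norm ball at a time, while a neighbourhood in the product
  topology on pairs must contain a product of convex sets meeting every step.
  \<open>silva_nbhd0_of_ball_condition\<close> is therefore stated for finite families with one
  \<open>V\<close> for all coordinates, so that joint continuity comes out directly. The same device
  carries the derivatives: base point and directions form one finite family, and the derivative of
  order k is a map on such families. The exponent 1/2 comes from a differential equation. If
  \<open>d\<close> is majorized by K P, stripping x_0 from the composition produces K P^2 (1 + m K
  P), of degree 3 in P. As P has constant term 1 and nonnegative coefficients, this is at most K (1
  + m K) P^3, and P' = (L/2) P^3 is solved by P = (1 - L z) powr (-1/2). Hence the constant L = 2 K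
  (1 + m K).\<close>

definition shift :: "nat \<Rightarrow> (nat list \<Rightarrow> 'k) \<Rightarrow> nat list \<Rightarrow> 'k" where
  "shift i a \<nu> = a (i # \<nu>)"

lemma shc_Nil_right: "shc \<eta> [] \<nu> = (if \<nu> = \<eta> then 1 else 0)"
  by (cases \<eta>) auto

lemma Nil_in_subseqs [simp]: "[] \<in> set (subseqs \<nu>)"
  by (induction \<nu>) (auto simp: Let_def)

lemma shc_nonzeroD:
  "shc \<eta> \<xi> \<nu> \<noteq> 0 \<Longrightarrow>
    length \<eta> + length \<xi> = length \<nu> \<and> \<eta> \<in> set (subseqs \<nu>) \<and> \<xi> \<in> set (subseqs \<nu>)"
proof (induction \<eta> \<xi> \<nu> rule: shc.induct)
  case (1 \<xi> \<nu>)
  then show ?case by (auto simp: subseqs_refl split: if_splits)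
next
  case (2 a \<eta> \<nu>)
  then show ?case by (auto simp: subseqs_refl simp del: subseqs.simps split: if_splits)
next
  case (3 a \<eta> b \<xi>)
  then show ?case by simp
next
  case (4 a \<eta> b \<xi> c \<nu>)
  then show ?case by (fastforce simp: Let_def split: if_splits)
qed

text \<open>\<open>shc\<close> vanishes off the pairs of the definition, so the sum may run over any
  finite rectangle containing them. A rectangle carries no length condition and can be reindexed one
  factor at a time.\<close>

lemma shuffle_eq_sum:
  assumes "finite A" "finite B" "set (subseqs \<nu>) \<subseteq> A" "set (subseqs \<nu>) \<subseteq> B"
  shows "shuffle a b \<nu> = (\<Sum>\<eta>\<in>A. \<Sum>\<xi>\<in>B. a \<eta> * b \<xi> * of_nat (shc \<eta> \<xi> \<nu>))"
proof -
  have "shuffle a b \<nu> = (\<Sum>(\<eta>, \<xi>)\<in>A \<times> B. a \<eta> * b \<xi> * of_nat (shc \<eta> \<xi> \<nu>))"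
    unfolding shuffle_def
  proof (rule sum.mono_neutral_left)
    show "finite (A \<times> B)" using assms by simp
    show "{(\<eta>, \<xi>). \<eta> \<in> set (subseqs \<nu>) \<and> \<xi> \<in> set (subseqs \<nu>) \<and>
       length \<eta> + length \<xi> = length \<nu>} \<subseteq> A \<times> B" using assms by auto
    show "\<forall>p\<in>A \<times> B - {(\<eta>, \<xi>). \<eta> \<in> set (subseqs \<nu>) \<and> \<xi> \<in> set (subseqs \<nu>) \<and>
       length \<eta> + length \<xi> = length \<nu>}. (case p of (\<eta>, \<xi>) \<Rightarrow> a \<eta> * b \<xi> * of_nat (shc \<eta> \<xi> \<nu>)) = 0"
    proof
      fix p
      assume p: "p \<in> A \<times> B - {(\<eta>, \<xi>). \<eta> \<in> set (subseqs \<nu>) \<and> \<xi> \<in> set (subseqs \<nu>) \<and>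
        length \<eta> + length \<xi> = length \<nu>}"
      obtain \<eta> \<xi> where [simp]: "p = (\<eta>, \<xi>)" by (cases p)
      have "shc \<eta> \<xi> \<nu> = 0" using p shc_nonzeroD[of \<eta> \<xi> \<nu>] by simp blast
      then show "(case p of (\<eta>, \<xi>) \<Rightarrow> a \<eta> * b \<xi> * of_nat (shc \<eta> \<xi> \<nu>)) = 0" by simp
    qed
  qed
  then show ?thesis by (simp add: sum.cartesian_product)
qed

lemma shuffle_Nil [simp]: "shuffle a b [] = a [] * b []"
  by (subst shuffle_eq_sum[of "{[]}" "{[]}"]) auto

lemma shc_Cons:
  "shc \<eta> \<xi> (i # \<nu>) =
     (case \<eta> of [] \<Rightarrow> 0 | x # \<eta>' \<Rightarrow> if x = i then shc \<eta>' \<xi> \<nu> else 0) +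
     (case \<xi> of [] \<Rightarrow> 0 | x # \<xi>' \<Rightarrow> if x = i then shc \<eta> \<xi>' \<nu> else 0)"
  by (cases \<eta>; cases \<xi>) (auto simp: shc_Nil_right)

lemma sum_over_Cons:
  fixes g :: "nat list \<Rightarrow> 'k::comm_monoid_add"
  assumes "finite A" "\<And>\<eta>. \<eta> \<in> A \<longleftrightarrow> i # \<eta> \<in> B" "finite B"
  shows "(\<Sum>\<eta>\<in>B. case \<eta> of [] \<Rightarrow> 0 | x # \<eta>' \<Rightarrow> if x = i then g \<eta>' else 0) = (\<Sum>\<eta>\<in>A. g \<eta>)"
proof -
  have "(\<Sum>\<eta>\<in>B. case \<eta> of [] \<Rightarrow> 0 | x # \<eta>' \<Rightarrow> if x = i then g \<eta>' else 0)
      = (\<Sum>\<eta>\<in>(#) i ` A. case \<eta> of [] \<Rightarrow> 0 | x # \<eta>' \<Rightarrow> if x = i then g \<eta>' else 0)"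
    by (rule sum.mono_neutral_right) (use assms in \<open>auto split: list.splits\<close>)
  also have "\<dots> = (\<Sum>\<eta>\<in>A. g \<eta>)"
    by (subst sum.reindex) auto
  finally show ?thesis .
qed

text \<open>The first letter of a shuffled word comes from the left or from the right factor. With
  \<open>shuffle_Nil\<close> this recursion determines the product, so the laws below are inductions
  on the word with the factors generalized.\<close>

lemma shuffle_Cons [simp]:
  "shuffle a b (i # \<nu>) = shuffle (shift i a) b \<nu> + shuffle a (shift i b) \<nu>"
proof -
  let ?S = "set (subseqs (i # \<nu>))" and ?B = "{\<eta>. i # \<eta> \<in> set (subseqs (i # \<nu>))}"
  \<comment> \<open>\<open>shuffle_eq_sum\<close> accepts any finite superset of the subsequences,
    so \<open>?B\<close> is only shown to be finite and large enough.\<close>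
  have finB: "finite ?B"
    by (rule finite_subset[of _ "set (subseqs \<nu>) \<union> tl ` set (subseqs \<nu>)"])
      (force simp: Let_def image_iff)+
  have sub: "set (subseqs \<nu>) \<subseteq> ?S" "set (subseqs \<nu>) \<subseteq> ?B" by (auto simp: Let_def)
  have "shuffle a b (i # \<nu>) = (\<Sum>\<eta>\<in>?S. \<Sum>\<xi>\<in>?S. a \<eta> * b \<xi> * of_nat (shc \<eta> \<xi> (i # \<nu>)))"
    by (rule shuffle_eq_sum) auto
  also have "\<dots> = (\<Sum>\<eta>\<in>?S. \<Sum>\<xi>\<in>?S. a \<eta> * b \<xi> *
        of_nat (case \<eta> of [] \<Rightarrow> 0 | x # \<eta>' \<Rightarrow> if x = i then shc \<eta>' \<xi> \<nu> else 0)) +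
      (\<Sum>\<eta>\<in>?S. \<Sum>\<xi>\<in>?S. a \<eta> * b \<xi> *
        of_nat (case \<xi> of [] \<Rightarrow> 0 | x # \<xi>' \<Rightarrow> if x = i then shc \<eta> \<xi>' \<nu> else 0))"
    by (simp only: shc_Cons of_nat_add distrib_left sum.distrib)
  also have "(\<Sum>\<eta>\<in>?S. \<Sum>\<xi>\<in>?S. a \<eta> * b \<xi> *
        of_nat (case \<eta> of [] \<Rightarrow> 0 | x # \<eta>' \<Rightarrow> if x = i then shc \<eta>' \<xi> \<nu> else 0))
     = (\<Sum>\<eta>\<in>?S. case \<eta> of [] \<Rightarrow> 0 | x # \<eta>' \<Rightarrow>
          if x = i then (\<Sum>\<xi>\<in>?S. shift i a \<eta>' * b \<xi> * of_nat (shc \<eta>' \<xi> \<nu>)) else 0)"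
    by (intro sum.cong refl) (auto simp: shift_def split: list.splits)
  also have "\<dots> = (\<Sum>\<eta>\<in>?B. \<Sum>\<xi>\<in>?S. shift i a \<eta> * b \<xi> * of_nat (shc \<eta> \<xi> \<nu>))"
    by (rule sum_over_Cons) (use finB in auto)
  also have "\<dots> = shuffle (shift i a) b \<nu>"
    by (rule shuffle_eq_sum[symmetric]) (use finB sub in auto)
  also have "(\<Sum>\<eta>\<in>?S. \<Sum>\<xi>\<in>?S. a \<eta> * b \<xi> *
        of_nat (case \<xi> of [] \<Rightarrow> 0 | x # \<xi>' \<Rightarrow> if x = i then shc \<eta> \<xi>' \<nu> else 0))
     = (\<Sum>\<eta>\<in>?S. \<Sum>\<xi>\<in>?S. case \<xi> of [] \<Rightarrow> 0 | x # \<xi>' \<Rightarrow>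
          if x = i then a \<eta> * shift i b \<xi>' * of_nat (shc \<eta> \<xi>' \<nu>) else 0)"
    by (intro sum.cong refl) (auto simp: shift_def split: list.splits)
  also have "\<dots> = (\<Sum>\<eta>\<in>?S. \<Sum>\<xi>\<in>?B. a \<eta> * shift i b \<xi> * of_nat (shc \<eta> \<xi> \<nu>))"
    by (intro sum.cong refl sum_over_Cons) (use finB in auto)
  also have "\<dots> = shuffle a (shift i b) \<nu>"
    by (rule shuffle_eq_sum[symmetric]) (use finB sub in auto)
  finally show ?thesis .
qed

lemma shift_add: "shift i (\<lambda>\<nu>. a \<nu> + b \<nu>) = (\<lambda>\<nu>. shift i a \<nu> + shift i b \<nu>)"
  by (auto simp: shift_def)

lemma shift_scale: "shift i (\<lambda>\<nu>. s * a \<nu>) = (\<lambda>\<nu>. s * shift i a \<nu>)"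
  by (auto simp: shift_def)

lemma shift_shuffle: "shift i (shuffle a b) = (\<lambda>\<nu>. shuffle (shift i a) b \<nu> + shuffle a (shift i b) \<nu>)"
  by (auto simp: shift_def)

lemma shift_zero: "shift i (\<lambda>_. 0) = (\<lambda>_. 0)"
  by (auto simp: shift_def)

lemma shuffle_commute: "shuffle a b \<nu> = shuffle b a \<nu>"
  by (induction \<nu> arbitrary: a b) (auto simp: add.commute mult.commute)

lemma shuffle_add_left: "shuffle (\<lambda>\<eta>. a \<eta> + a' \<eta>) b \<nu> = shuffle a b \<nu> + shuffle a' b \<nu>"
  by (induction \<nu> arbitrary: a a' b) (auto simp: shift_add algebra_simps)

lemma shuffle_add_right: "shuffle b (\<lambda>\<eta>. a \<eta> + a' \<eta>) \<nu> = shuffle b a \<nu> + shuffle b a' \<nu>"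
  by (metis shuffle_add_left shuffle_commute)

lemma shuffle_zero_left [simp]: "shuffle (\<lambda>_. 0) b \<nu> = 0"
  by (induction \<nu> arbitrary: b) (auto simp: shift_zero)

lemma shuffle_zero_right [simp]: "shuffle b (\<lambda>_. 0) \<nu> = 0"
  by (metis shuffle_zero_left shuffle_commute)

lemma shuffle_scale_right: "shuffle b (\<lambda>\<eta>. s * a \<eta>) \<nu> = s * shuffle b a \<nu>"
  by (induction \<nu> arbitrary: a b) (auto simp: shift_scale algebra_simps)

lemma shuffle_sum_right: "shuffle b (\<lambda>\<eta>. \<Sum>i\<in>I. a i \<eta>) \<nu> = (\<Sum>i\<in>I. shuffle b (a i) \<nu>)"
  by (induction I rule: infinite_finite_induct) (auto simp: shuffle_add_right)

lemma shuffle_sum_left: "shuffle (\<lambda>\<eta>. \<Sum>i\<in>I. a i \<eta>) b \<nu> = (\<Sum>i\<in>I. shuffle (a i) b \<nu>)"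
  by (induction I rule: infinite_finite_induct) (auto simp: shuffle_add_left)

lemma shuffle_assoc: "shuffle (shuffle a b) c \<nu> = shuffle a (shuffle b c) \<nu>"
  by (induction \<nu> arbitrary: a b c)
    (auto simp: shift_shuffle shuffle_add_left shuffle_add_right algebra_simps)

text \<open>Lets an identity known only up to a certain length be used inside a shuffle; the
  inductions on length below apply their hypotheses this way.\<close>

lemma shuffle_cong:
  assumes "\<And>\<eta>. length \<eta> \<le> length \<nu> \<Longrightarrow> a \<eta> = a' \<eta>" "\<And>\<eta>. length \<eta> \<le> length \<nu> \<Longrightarrow> b \<eta> = b' \<eta>"
  shows "shuffle a b \<nu> = shuffle a' b' \<nu>"
  using assms
proof (induction \<nu> arbitrary: a a' b b')
  case (Cons i \<nu>)
  have "shuffle (shift i a) b \<nu> = shuffle (shift i a') b' \<nu>"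
    by (rule Cons.IH) (use Cons.prems in \<open>auto simp: shift_def\<close>)
  moreover have "shuffle a (shift i b) \<nu> = shuffle a' (shift i b') \<nu>"
    by (rule Cons.IH) (use Cons.prems in \<open>auto simp: shift_def\<close>)
  ultimately show ?case by simp
qed simp

lemma shuffle_left_commute: "shuffle a (shuffle b c) \<nu> = shuffle b (shuffle a c) \<nu>"
proof -
  have "shuffle a (shuffle b c) \<nu> = shuffle (shuffle a b) c \<nu>" by (simp add: shuffle_assoc)
  also have "\<dots> = shuffle (shuffle b a) c \<nu>"
    by (rule shuffle_cong) (auto simp: shuffle_commute)
  finally show ?thesis by (simp add: shuffle_assoc)
qed

section \<open>Mixed composition as an operator on scalar series\<close>

definition words :: "nat \<Rightarrow> nat \<Rightarrow> nat list set" where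
  "words m n = {\<eta>. set \<eta> \<subseteq> {0..m} \<and> length \<eta> \<le> n}"

lemma finite_words: "finite (words m n)"
  unfolding words_def by (rule finite_lists_length_le) simp

lemma words_Suc: "words m (Suc n) = insert [] ((\<lambda>(i, \<eta>). i # \<eta>) ` ({0..m} \<times> words m n))"
proof -
  have "\<eta> \<in> words m (Suc n) \<longleftrightarrow> \<eta> \<in> insert [] ((\<lambda>(i, \<eta>). i # \<eta>) ` ({0..m} \<times> words m n))" for \<eta>
    by (cases \<eta>) (auto simp: words_def)
  then show ?thesis by blast
qed

text \<open>This is one component of \<open>c\<close>. In this argument order
  \<open>scomp m d\<close> is a linear operator on scalar series, and \<open>scomp_shuffle\<close>
  shows that it is multiplicative.\<close>

definition scomp :: "nat \<Rightarrow> 'k::comm_ring_1 ser \<Rightarrow> (nat list \<Rightarrow> 'k) \<Rightarrow> nat list \<Rightarrow> 'k" where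
  "scomp m d c \<nu> = (\<Sum>\<eta>\<in>words m (length \<nu>). c \<eta> * phi d \<eta> one_ser \<nu>)"

lemma mixed_comp_eq: "mixed_comp m c d = (\<lambda>\<nu> k. scomp m d (\<lambda>\<eta>. c \<eta> k) \<nu>)"
  unfolding mixed_comp_def scomp_def words_def by simp

lemma phi1_Nil: "phi1 d i e [] = 0"
  by (simp add: phi1_def lcat_def)

lemma phi1_Cons:
  "phi1 d i e (j # \<nu>) = (if j = i then e \<nu> else 0) +
     (if i \<noteq> 0 \<and> j = 0 then shuffle (\<lambda>\<eta>. d \<eta> i) e \<nu> else 0)"
  by (auto simp: phi1_def lcat_def)

text \<open>Each letter of \<open>\<eta>\<close> makes \<open>phi1\<close> put one more letter in
  front. Hence the truncation by length in \<open>mixed_comp\<close> drops only zero terms.\<close>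

lemma phi_eq_0: "length \<nu> < length \<eta> \<Longrightarrow> phi d \<eta> one_ser \<nu> = 0"
proof (induction \<eta> arbitrary: \<nu>)
  case (Cons i \<eta>)
  show ?case
  proof (cases \<nu>)
    case Nil
    then show ?thesis by (simp add: phi1_Nil)
  next
    case (Cons j \<nu>')
    have "shuffle (\<lambda>\<eta>. d \<eta> i) (phi d \<eta> one_ser) \<nu>' = shuffle (\<lambda>\<eta>. d \<eta> i) (\<lambda>_. 0) \<nu>'"
      by (rule shuffle_cong) (use Cons.IH Cons.prems Cons in auto)
    then show ?thesis using Cons.IH[of \<nu>'] Cons.prems Cons by (auto simp: phi1_Cons)
  qed
qed simp

lemma scomp_eq_sum:
  assumes "length \<nu> \<le> n"
  shows "scomp m d c \<nu> = (\<Sum>\<eta>\<in>words m n. c \<eta> * phi d \<eta> one_ser \<nu>)"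
  unfolding scomp_def
proof (rule sum.mono_neutral_left)
  show "\<forall>i\<in>words m n - words m (length \<nu>). c i * phi d i one_ser \<nu> = 0"
    by (auto simp: words_def phi_eq_0 not_le)
qed (use assms finite_words in \<open>auto simp: words_def\<close>)

lemma scomp_Nil [simp]: "scomp m d c [] = c []"
proof -
  have "words m 0 = {[]}" by (auto simp: words_def)
  then show ?thesis by (simp add: scomp_def one_ser_def)
qed

text \<open>Stripping x_j commutes with the composition, except that x_0 also collects the terms x_0
  (d[i] shuffle e) of \<open>phi1\<close>. The multiplicativity, the composition law and the growth
  bound below are all read off from this recursion.\<close>

lemma scomp_Cons:
  "scomp m d c (j # \<nu>) = (if j \<le> m then scomp m d (shift j c) \<nu> else 0) +
     (if j = 0 then \<Sum>i=1..m. shuffle (\<lambda>\<eta>. d \<eta> i) (scomp m d (shift i c)) \<nu> else 0)"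
proof -
  let ?W = "words m (length \<nu>)" and ?p = "\<lambda>\<eta>. phi d \<eta> one_ser"
  have sh: "(\<Sum>\<eta>\<in>?W. c (i # \<eta>) * shuffle (\<lambda>\<eta>. d \<eta> i) (?p \<eta>) \<nu>)
     = shuffle (\<lambda>\<eta>. d \<eta> i) (scomp m d (shift i c)) \<nu>" for i
  proof -
    have "(\<Sum>\<eta>\<in>?W. c (i # \<eta>) * shuffle (\<lambda>\<eta>. d \<eta> i) (?p \<eta>) \<nu>)
       = shuffle (\<lambda>\<eta>. d \<eta> i) (\<lambda>\<nu>'. \<Sum>\<eta>\<in>?W. c (i # \<eta>) * ?p \<eta> \<nu>') \<nu>"
      by (simp add: shuffle_sum_right shuffle_scale_right)
    also have "\<dots> = shuffle (\<lambda>\<eta>. d \<eta> i) (scomp m d (shift i c)) \<nu>"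
      by (rule shuffle_cong) (auto simp: scomp_eq_sum shift_def)
    finally show ?thesis .
  qed
  have "scomp m d c (j # \<nu>) = (\<Sum>\<eta>\<in>words m (Suc (length \<nu>)). c \<eta> * ?p \<eta> (j # \<nu>))"
    by (simp add: scomp_def)
  also have "\<dots> = (\<Sum>(i, \<eta>)\<in>{0..m} \<times> ?W. c (i # \<eta>) * phi1 d i (?p \<eta>) (j # \<nu>))"
    unfolding words_Suc using finite_words
    by (subst sum.insert)
       (auto simp: one_ser_def sum.reindex inj_on_def intro!: sum.cong)
  also have "\<dots> = (\<Sum>i=0..m. \<Sum>\<eta>\<in>?W. c (i # \<eta>) * phi1 d i (?p \<eta>) (j # \<nu>))"
    by (simp add: sum.cartesian_product)
  also have "\<dots> = (\<Sum>i=0..m. (if i = j then \<Sum>\<eta>\<in>?W. c (i # \<eta>) * ?p \<eta> \<nu> else 0) +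
      (if i \<noteq> 0 \<and> j = 0 then \<Sum>\<eta>\<in>?W. c (i # \<eta>) * shuffle (\<lambda>\<eta>. d \<eta> i) (?p \<eta>) \<nu> else 0))"
    by (intro sum.cong refl) (auto simp: phi1_Cons distrib_left sum.distrib)
  also have "\<dots> = (\<Sum>i=0..m. (if i = j then scomp m d (shift i c) \<nu> else 0)) +
      (\<Sum>i=0..m. (if i \<noteq> 0 \<and> j = 0 then shuffle (\<lambda>\<eta>. d \<eta> i) (scomp m d (shift i c)) \<nu> else 0))"
    unfolding sum.distrib sh by (simp add: scomp_def shift_def)
  \<comment> \<open>The index 0 drops out because d[0] = 0.\<close>
  also have "(\<Sum>i=0..m. (if i \<noteq> 0 \<and> j = 0 then shuffle (\<lambda>\<eta>. d \<eta> i) (scomp m d (shift i c)) \<nu> else 0))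
     = (if j = 0 then \<Sum>i=1..m. shuffle (\<lambda>\<eta>. d \<eta> i) (scomp m d (shift i c)) \<nu> else 0)"
    by (subst sum.atLeast_Suc_atMost) auto
  finally show ?thesis by (auto simp: sum.delta)
qed

lemma shift_scomp:
  "shift j (scomp m d c) = (\<lambda>\<nu>. (if j \<le> m then scomp m d (shift j c) \<nu> else 0) +
     (if j = 0 then \<Sum>i=1..m. shuffle (\<lambda>\<eta>. d \<eta> i) (scomp m d (shift i c)) \<nu> else 0))"
  unfolding shift_def[of j "scomp m d c"] scomp_Cons ..

lemma scomp_add: "scomp m d (\<lambda>\<eta>. a \<eta> + b \<eta>) \<nu> = scomp m d a \<nu> + scomp m d b \<nu>"
  by (simp add: scomp_def distrib_right sum.distrib)

lemma scomp_zero [simp]: "scomp m d (\<lambda>_. 0) \<nu> = 0"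
  by (simp add: scomp_def)

lemma scomp_sum: "scomp m d (\<lambda>\<eta>. \<Sum>i\<in>I. a i \<eta>) \<nu> = (\<Sum>i\<in>I. scomp m d (a i) \<nu>)"
  by (induction I rule: infinite_finite_induct) (auto simp: scomp_add)

text \<open>The inequality is strict because \<open>d\<close> occurs only behind an x_0 that the
  composition itself puts in front. This makes the equation d = - (c o d) solvable length by
  length.\<close>

lemma scomp_cong_right:
  assumes "\<And>\<eta> i. length \<eta> < length \<nu> \<Longrightarrow> d \<eta> i = d' \<eta> i"
  shows "scomp m d c \<nu> = scomp m d' c \<nu>"
  using assms
proof (induction "length \<nu>" arbitrary: \<nu> c rule: less_induct)
  case less
  show ?case
  proof (cases \<nu>)
    case (Cons j \<nu>')
    have *: "scomp m d c \<eta> = scomp m d' c \<eta>" if "length \<eta> \<le> length \<nu>'" for \<eta> c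
      by (rule less.hyps) (use that Cons less.prems in auto)
    have "shuffle (\<lambda>\<eta>. d \<eta> i) (scomp m d (shift i c)) \<nu>' = shuffle (\<lambda>\<eta>. d' \<eta> i) (scomp m d' (shift i c)) \<nu>'" for i
      by (rule shuffle_cong) (use * less.prems Cons in auto)
    then show ?thesis using * by (simp add: Cons scomp_Cons)
  qed simp
qed

text \<open>Both sides obey the same recursion: the shift is a derivation, and shuffling with d[i]
  can be moved to either factor by commutativity and associativity.\<close>

lemma scomp_shuffle: "scomp m d (shuffle a b) \<nu> = shuffle (scomp m d a) (scomp m d b) \<nu>"
proof (induction "length \<nu>" arbitrary: \<nu> a b rule: less_induct)
  case less
  show ?case
  proof (cases \<nu>)
    case (Cons j \<nu>')
    have IH: "scomp m d (shuffle a b) \<eta> = shuffle (scomp m d a) (scomp m d b) \<eta>"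
      if "length \<eta> \<le> length \<nu>'" for \<eta> a b
      by (rule less.hyps) (use that Cons in auto)
    have IH': "scomp m d (shift i (shuffle a b)) \<eta> =
       shuffle (scomp m d (shift i a)) (scomp m d b) \<eta> + shuffle (scomp m d a) (scomp m d (shift i b)) \<eta>"
      if "length \<eta> \<le> length \<nu>'" for \<eta> i
      using that by (simp add: shift_shuffle scomp_add IH)
    have sh: "shuffle (\<lambda>\<eta>. d \<eta> i) (scomp m d (shift i (shuffle a b))) \<nu>' =
       shuffle (shuffle (\<lambda>\<eta>. d \<eta> i) (scomp m d (shift i a))) (scomp m d b) \<nu>' +
       shuffle (scomp m d a) (shuffle (\<lambda>\<eta>. d \<eta> i) (scomp m d (shift i b))) \<nu>'" for i
    proof -
      have "shuffle (\<lambda>\<eta>. d \<eta> i) (scomp m d (shift i (shuffle a b))) \<nu>' =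
        shuffle (\<lambda>\<eta>. d \<eta> i) (\<lambda>\<eta>. shuffle (scomp m d (shift i a)) (scomp m d b) \<eta> +
           shuffle (scomp m d a) (scomp m d (shift i b)) \<eta>) \<nu>'"
        by (rule shuffle_cong) (auto simp: IH')
      then show ?thesis
        by (simp add: shuffle_add_right shuffle_assoc shuffle_left_commute)
    qed
    show ?thesis
      unfolding Cons scomp_Cons shuffle_Cons shift_scomp sh
      by (auto simp: IH' shuffle_add_left shuffle_add_right shuffle_sum_left shuffle_sum_right sum.distrib)
  qed simp
qed

text \<open>At x_0 the outer composition meets the inner terms with d[i], and multiplicativity turns
  d[i] into its composite with \<open>e\<close>; adding the outer terms with e[i] gives the
  components of e + d o e, the group product. Associativity follows by applying this in each
  component.\<close>

lemma scomp_scomp: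
  "scomp m e (scomp m d c) \<nu> = scomp m (gmult m d e) c \<nu>"
proof (induction "length \<nu>" arbitrary: \<nu> c rule: less_induct)
  case less
  show ?case
  proof (cases \<nu>)
    case (Cons j \<nu>')
    have IH: "scomp m e (scomp m d c) \<eta> = scomp m (gmult m d e) c \<eta>"
      if "length \<eta> \<le> length \<nu>'" for \<eta> c
      by (rule less.hyps) (use that Cons in auto)
    have g: "(\<lambda>\<eta>. gmult m d e \<eta> i) = (\<lambda>\<eta>. e \<eta> i + scomp m e (\<lambda>\<eta>. d \<eta> i) \<eta>)" for i
      by (simp add: gmult_def mixed_comp_eq)
    have sh: "shuffle x (scomp m (gmult m d e) c) \<nu>' = shuffle x (scomp m e (scomp m d c)) \<nu>'" for x c
      by (rule shuffle_cong) (auto simp: IH)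
    \<comment> \<open>A letter other than x_0 is stripped without extra terms.\<close>
    have eq: "scomp m e (shift i (scomp m d c)) = (\<lambda>\<nu>. scomp m e (scomp m d (shift i c)) \<nu>)"
      if "i \<in> {1..m}" for i
      using that by (simp add: shift_scomp)
    show ?thesis
      unfolding Cons scomp_Cons g sh
      using IH[of \<nu>' "shift j c"]
      by (auto simp: shift_scomp scomp_add scomp_sum scomp_shuffle shuffle_add_left sum.distrib)
  qed simp
qed

lemma gmult_assoc: "gmult m (gmult m c d) e = gmult m c (gmult m d e)"
proof (intro ext)
  fix \<nu> k
  have "gmult m (gmult m c d) e \<nu> k
      = e \<nu> k + scomp m e (\<lambda>\<eta>. d \<eta> k + scomp m d (\<lambda>\<eta>. c \<eta> k) \<eta>) \<nu>"
    by (simp add: gmult_def mixed_comp_eq)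
  also have "\<dots> = e \<nu> k + scomp m e (\<lambda>\<eta>. d \<eta> k) \<nu> + scomp m (gmult m d e) (\<lambda>\<eta>. c \<eta> k) \<nu>"
    by (simp add: scomp_add scomp_scomp)
  also have "\<dots> = gmult m c (gmult m d e) \<nu> k"
    by (simp add: gmult_def mixed_comp_eq)
  finally show "gmult m (gmult m c d) e \<nu> k = gmult m c (gmult m d e) \<nu> k" .
qed

lemma scomp_0_right:
  assumes "\<And>\<eta>. \<not> set \<eta> \<subseteq> {0..m} \<Longrightarrow> c \<eta> = 0"
  shows "scomp m 0 c \<nu> = c \<nu>"
  using assms
proof (induction \<nu> arbitrary: c)
  case (Cons j \<nu>)
  have "scomp m 0 (shift j c) \<nu> = shift j c \<nu>"
    by (rule Cons.IH) (use Cons.prems in \<open>auto simp: shift_def\<close>)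
  moreover have "j > m \<Longrightarrow> c (j # \<nu>) = 0" using Cons.prems by auto
  ultimately show ?case by (auto simp: scomp_Cons shift_def zero_fun_def)
qed simp

lemma gmult_0_right: "wf_ser m c \<Longrightarrow> gmult m c 0 = c"
  by (intro ext) (auto simp: gmult_def mixed_comp_eq scomp_0_right wf_ser_def)

lemma gmult_0_left: "gmult m 0 d = d"
  by (intro ext) (auto simp: gmult_def mixed_comp_eq)

lemma shuffle_nonwf:
  assumes "\<And>\<eta>. \<not> set \<eta> \<subseteq> A \<Longrightarrow> a \<eta> = 0" "\<And>\<eta>. \<not> set \<eta> \<subseteq> A \<Longrightarrow> b \<eta> = 0" "\<not> set \<nu> \<subseteq> A"
  shows "shuffle a b \<nu> = 0"
  using assms
proof (induction \<nu> arbitrary: a b)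
  case (Cons j \<nu>)
  show ?case
  proof (cases "j \<in> A")
    case True
    have "shuffle (shift j a) b \<nu> = 0" "shuffle a (shift j b) \<nu> = 0"
      by (rule Cons.IH; use Cons.prems True in \<open>auto simp: shift_def\<close>)+
    then show ?thesis by simp
  next
    case False
    then have "shift j a = (\<lambda>_. 0)" "shift j b = (\<lambda>_. 0)"
      using Cons.prems by (auto simp: shift_def)
    then show ?thesis by simp
  qed
qed simp

lemma scomp_nonwf:
  assumes "wf_ser m d" "\<not> set \<nu> \<subseteq> {0..m}"
  shows "scomp m d c \<nu> = 0"
  using assms(2)
proof (induction "length \<nu>" arbitrary: \<nu> c rule: less_induct)
  case less
  show ?case
  proof (cases \<nu>)
    case Nil
    then show ?thesis using less.prems by simp
  next
    case (Cons j \<nu>')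
    show ?thesis
    proof (cases "j \<le> m")
      case True
      then have nw: "\<not> set \<nu>' \<subseteq> {0..m}" using less.prems Cons by auto
      have *: "scomp m d c \<eta> = 0" if "length \<eta> \<le> length \<nu>'" "\<not> set \<eta> \<subseteq> {0..m}" for \<eta> c
        by (rule less.hyps) (use that Cons in auto)
      \<comment> \<open>The induction hypothesis reaches only words no longer than
        \<open>\<nu>'\<close>, while \<open>shuffle_nonwf\<close> wants the support condition
        everywhere. Cutting the factor off outside the alphabet leaves this coefficient
        unchanged.\<close>
      have "shuffle (\<lambda>\<eta>. d \<eta> i) (scomp m d (shift i c)) \<nu>' =
          shuffle (\<lambda>\<eta>. d \<eta> i) (\<lambda>\<eta>. if set \<eta> \<subseteq> {0..m} then scomp m d (shift i c) \<eta> else 0) \<nu>'" for i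
        by (rule shuffle_cong) (auto simp: *)
      also have "\<dots> i = 0" for i
        by (rule shuffle_nonwf[of "{0..m}"]) (use nw assms in \<open>auto simp: wf_ser_def\<close>)
      finally show ?thesis using * nw by (auto simp: Cons scomp_Cons)
    qed (simp add: Cons scomp_Cons)
  qed
qed

lemma wf_ser_mixed_comp: "wf_ser m c \<Longrightarrow> wf_ser m d \<Longrightarrow> wf_ser m (mixed_comp m c d)"
  unfolding wf_ser_def[of m "mixed_comp m c d"]
proof (intro allI impI, elim disjE)
  fix \<eta> i assume "wf_ser m c" "i \<notin> {1..m}"
  then have "(\<lambda>\<eta>. c \<eta> i) = (\<lambda>_. 0)" unfolding wf_ser_def by blast
  then show "mixed_comp m c d \<eta> i = 0" by (simp only: mixed_comp_eq scomp_zero)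
qed (simp add: mixed_comp_eq scomp_nonwf)

section \<open>The inverse as a fixed point\<close>

fun inv_approx :: "nat \<Rightarrow> 'k::comm_ring_1 ser \<Rightarrow> nat \<Rightarrow> 'k ser" where
  "inv_approx m c 0 = 0"
| "inv_approx m c (Suc n) = - mixed_comp m c (inv_approx m c n)"

text \<open>After n iterations of d = - (c o d) from 0, all words of length less than n have their
  final value. This explains the \<open>Suc\<close>, and no convergence is involved.\<close>

definition ginv :: "nat \<Rightarrow> 'k::comm_ring_1 ser \<Rightarrow> 'k ser" where
  "ginv m c \<nu> k = inv_approx m c (Suc (length \<nu>)) \<nu> k"

lemma inv_approx_stable:
  "length \<nu> < n \<Longrightarrow> n \<le> n' \<Longrightarrow> inv_approx m c n' \<nu> k = inv_approx m c n \<nu> k"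
proof (induction n arbitrary: n' \<nu> k)
  case (Suc n)
  then obtain n'' where n': "n' = Suc n''" "n \<le> n''" by (cases n') auto
  have "scomp m (inv_approx m c n'') (\<lambda>\<eta>. c \<eta> k) \<nu> = scomp m (inv_approx m c n) (\<lambda>\<eta>. c \<eta> k) \<nu>"
    by (intro scomp_cong_right Suc.IH) (use Suc.prems n' in simp_all)
  then show ?case using n' by (simp add: mixed_comp_eq)
qed simp

text \<open>Unfolding one of the \<open>Suc (length \<nu>)\<close> iterations leaves an iterate that
  is already correct on shorter words, and by \<open>scomp_cong_right\<close> no others
  matter.\<close>

lemma ginv_fixpoint: "ginv m c \<nu> k = - scomp m (ginv m c) (\<lambda>\<eta>. c \<eta> k) \<nu>"
proof -
  have "scomp m (inv_approx m c (length \<nu>)) (\<lambda>\<eta>. c \<eta> k) \<nu> = scomp m (ginv m c) (\<lambda>\<eta>. c \<eta> k) \<nu>"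
    unfolding ginv_def by (intro scomp_cong_right inv_approx_stable) simp_all
  then show ?thesis by (simp add: ginv_def mixed_comp_eq)
qed

lemma gmult_ginv: "gmult m c (ginv m c) = 0"
  by (intro ext) (simp add: gmult_def mixed_comp_eq, subst ginv_fixpoint, simp)

lemma wf_ser_inv_approx: "wf_ser m c \<Longrightarrow> wf_ser m (inv_approx m c n)"
proof (induction n)
  case (Suc n)
  then show ?case using wf_ser_mixed_comp[of m c "inv_approx m c n"] by (simp add: wf_ser_def)
qed (simp add: wf_ser_def)

lemma wf_ser_ginv: "wf_ser m c \<Longrightarrow> wf_ser m (ginv m c)"
proof -
  assume "wf_ser m c"
  then have "wf_ser m (inv_approx m c n)" for n by (rule wf_ser_inv_approx)
  then show ?thesis unfolding wf_ser_def ginv_def by (metis (mono_tags, lifting))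
qed

section \<open>Growth estimates\<close>

lemma pochhammer_mono_left:
  fixes a b :: real
  assumes "0 \<le> a" "a \<le> b"
  shows "pochhammer a n \<le> pochhammer b n"
  unfolding pochhammer_prod using assms by (intro prod_mono) auto

text \<open>Factor by factor, k + 1 \<le> 2 (1/2 + k). Doubling the radius thus brings a series with
  weight n! under the majorant of exponent 1/2.\<close>

lemma fact_le_pochhammer_half: "fact n \<le> 2 ^ n * pochhammer (1/2 :: real) n"
proof (induction n)
  case (Suc n)
  have "(fact (Suc n) :: real) = (real n + 1) * fact n" by simp
  also have "\<dots> \<le> (2 * (1/2 + real n)) * (2 ^ n * pochhammer (1/2) n)"
    by (intro mult_mono Suc.IH) auto
  finally show ?case by (simp add: pochhammer_Suc algebra_simps)
qed simp

lemma pochhammer_half_le_fact: "pochhammer (1/2 :: real) n \<le> fact n"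
  using pochhammer_mono_left[of "1/2" 1 n] by (simp add: pochhammer_fact)

text \<open>In terms of exponential generating functions the bounds read
  \<open>\<alpha> (1 - L z) powr - a\<close>, so that the shuffle adds the exponents.\<close>
lemma norm_shuffle_le:
  fixes u v :: "nat list \<Rightarrow> 'k::real_normed_field"
  assumes "0 \<le> a" "0 \<le> b" "0 \<le> L" "0 \<le> \<alpha>" "0 \<le> \<beta>"
    and "\<And>\<eta>. length \<eta> \<le> length \<nu> \<Longrightarrow> norm (u \<eta>) \<le> \<alpha> * pochhammer a (length \<eta>) * L ^ length \<eta>"
    and "\<And>\<eta>. length \<eta> \<le> length \<nu> \<Longrightarrow> norm (v \<eta>) \<le> \<beta> * pochhammer b (length \<eta>) * L ^ length \<eta>"
  shows "norm (shuffle u v \<nu>) \<le> \<alpha> * \<beta> * pochhammer (a + b) (length \<nu>) * L ^ length \<nu>"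
  using assms
proof (induction \<nu> arbitrary: u v a b \<alpha> \<beta>)
  case Nil
  then show ?case using mult_mono[of "norm (u [])" \<alpha> "norm (v [])" \<beta>] by (auto simp: norm_mult)
next
  case (Cons i \<nu>)
  let ?n = "length \<nu>"
  \<comment> \<open>Stripping a letter differentiates the majorant: exponent a becomes a + 1 and a
    factor a L appears. Both summands end up with exponent a + b + 1, and their factors add up to (a
    + b) L, as the derivative of the product requires.\<close>
  have 1: "norm (shuffle (shift i u) v \<nu>) \<le> (\<alpha> * a * L) * \<beta> * pochhammer ((a + 1) + b) ?n * L ^ ?n"
  proof (rule Cons.IH)
    fix \<eta> :: "nat list" assume "length \<eta> \<le> ?n"
    then show "norm (shift i u \<eta>) \<le> \<alpha> * a * L * pochhammer (a + 1) (length \<eta>) * L ^ length \<eta>"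
      using Cons.prems(6)[of "i # \<eta>"] by (simp add: shift_def pochhammer_rec mult_ac)
  qed (use Cons.prems in auto)
  have 2: "norm (shuffle u (shift i v) \<nu>) \<le> \<alpha> * (\<beta> * b * L) * pochhammer (a + (b + 1)) ?n * L ^ ?n"
  proof (rule Cons.IH)
    fix \<eta> :: "nat list" assume "length \<eta> \<le> ?n"
    then show "norm (shift i v \<eta>) \<le> \<beta> * b * L * pochhammer (b + 1) (length \<eta>) * L ^ length \<eta>"
      using Cons.prems(7)[of "i # \<eta>"] by (simp add: shift_def pochhammer_rec mult_ac)
  qed (use Cons.prems in auto)
  have "norm (shuffle u v (i # \<nu>)) \<le> norm (shuffle (shift i u) v \<nu>) + norm (shuffle u (shift i v) \<nu>)"
    by (simp add: norm_triangle_ineq)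
  also have "\<dots> \<le> (\<alpha> * a * L) * \<beta> * pochhammer ((a + 1) + b) ?n * L ^ ?n +
      \<alpha> * (\<beta> * b * L) * pochhammer (a + (b + 1)) ?n * L ^ ?n"
    by (intro add_mono 1 2)
  also have "\<dots> = \<alpha> * \<beta> * pochhammer (a + b) (length (i # \<nu>)) * L ^ length (i # \<nu>)"
    by (simp add: pochhammer_rec add_ac algebra_simps)
  finally show ?case .
qed

text \<open>The generating function \<open>P = (1 - L z) powr (- 1/2)\<close> is a supersolution of
  \<open>P' = K P\<^sup>2 (1 + m K P)\<close>, the equation that majorizes both the composition and the fixed
  point equation of the inverse. The index \<open>j\<close> counts the letters already stripped off \<open>c\<close>.\<close>
lemma norm_scomp_le:
  fixes c :: "nat list \<Rightarrow> 'k::real_normed_field"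
  assumes K: "1 \<le> K" and L: "2 * K * (1 + real m * K) \<le> L"
    and d: "\<And>\<eta> i. length \<eta> < N \<Longrightarrow> norm (d \<eta> i) \<le> K * pochhammer (1/2) (length \<eta>) * L ^ length \<eta>"
    and "\<And>\<eta>. norm (c \<eta>) \<le> K ^ (Suc j + length \<eta>) * fact (length \<eta> + j)"
    and "length \<nu> \<le> N"
  shows "norm (scomp m d c \<nu>) \<le>
    fact j * K ^ Suc j * pochhammer ((real j + 1) / 2) (length \<nu>) * L ^ length \<nu>"
  using assms(4,5)
proof (induction "length \<nu>" arbitrary: \<nu> c j rule: less_induct)
  case less
  show ?case
  proof (cases \<nu>)
    case Nil
    then show ?thesis using less.prems(1)[of "[]"] by (simp add: mult.commute)
  next
    case (Cons l \<nu>')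
    let ?n = "length \<nu>'" and ?C = "fact (Suc j) * K ^ Suc (Suc j)"
    have L0: "0 \<le> L" using K L by (smt (verit) mult_nonneg_nonneg of_nat_0_le_iff)
    have C0: "0 \<le> ?C" using K by simp
    have IH: "norm (scomp m d (shift i c) \<eta>) \<le>
        ?C * pochhammer ((real j + 2) / 2) (length \<eta>) * L ^ length \<eta>"
      if "length \<eta> \<le> ?n" for \<eta> i
    proof -
      have "norm (scomp m d (shift i c) \<eta>) \<le>
        ?C * pochhammer ((real (Suc j) + 1) / 2) (length \<eta>) * L ^ length \<eta>"
      proof (rule less.hyps)
        fix \<eta> show "norm (shift i c \<eta>) \<le> K ^ (Suc (Suc j) + length \<eta>) * fact (length \<eta> + Suc j)"
          using less.prems(1)[of "i # \<eta>"] by (simp add: shift_def)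
      qed (use that Cons less.prems in auto)
      then show ?thesis by (simp add: add.commute)
    qed
    have sh: "norm (shuffle (\<lambda>\<eta>. d \<eta> i) (scomp m d (shift i c)) \<nu>') \<le>
        K * ?C * pochhammer (1/2 + (real j + 2) / 2) ?n * L ^ ?n" for i
      by (rule norm_shuffle_le) (use K L0 C0 IH d less.prems Cons in auto)
    \<comment> \<open>Stripping a letter from the claimed bound leaves the exponent (j + 1) / 2 + 1
      = (j + 3) / 2. The shuffle terms have it already; the term without \<open>d\<close> has (j +
      2) / 2 and is enlarged.\<close>
    define Q where "Q = pochhammer ((real j + 3) / 2) ?n * L ^ ?n"
    have Q0: "0 \<le> Q" unfolding Q_def using L0 by (simp add: pochhammer_nonneg)
    have 1: "norm (scomp m d (shift l c) \<nu>') \<le> ?C * Q"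
    proof -
      have "pochhammer ((real j + 2) / 2) ?n \<le> pochhammer ((real j + 3) / 2) ?n"
        by (rule pochhammer_mono_left) auto
      then have "?C * (pochhammer ((real j + 2) / 2) ?n * L ^ ?n) \<le> ?C * Q"
        unfolding Q_def using C0 L0 by (intro mult_left_mono mult_right_mono) auto
      then show ?thesis using order_trans[OF IH[of \<nu>' l, OF order_refl, unfolded mult.assoc]] by (simp only: mult.assoc)
    qed
    have 2: "norm (shuffle (\<lambda>\<eta>. d \<eta> i) (scomp m d (shift i c)) \<nu>') \<le> K * ?C * Q" for i
    proof -
      have "1/2 + (real j + 2) / 2 = (real j + 3) / 2" by (simp add: field_simps)
      then show ?thesis using sh[of i] unfolding Q_def by (simp only: mult.assoc)
    qed
    \<comment> \<open>The letter x_0 is the worst case; its bound serves all letters.\<close>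
    have "norm (scomp m d c \<nu>) \<le> norm (scomp m d (shift l c) \<nu>') +
        (\<Sum>i=1..m. norm (shuffle (\<lambda>\<eta>. d \<eta> i) (scomp m d (shift i c)) \<nu>'))"
      unfolding Cons scomp_Cons
      by (rule order_trans[OF norm_triangle_ineq], rule add_mono)
         (auto intro: sum_norm_le norm_sum sum_nonneg)
    also have "\<dots> \<le> ?C * Q + (\<Sum>i=1..m. K * ?C * Q)"
      by (intro add_mono sum_mono 1 2)
    \<comment> \<open>The factor (j + 1) / 2 is the one that \<open>pochhammer_rec\<close> produces,
      so the remaining 2 K (1 + m K) must not exceed L.\<close>
    also have "\<dots> = fact j * K ^ Suc j * ((real j + 1) / 2) * Q * (2 * K * (1 + real m * K))"
      by (simp add: field_simps)
    also have "\<dots> \<le> fact j * K ^ Suc j * ((real j + 1) / 2) * Q * L"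
      using K Q0 by (intro mult_left_mono L) auto
    also have "\<dots> = fact j * K ^ Suc j * pochhammer ((real j + 1) / 2) (length \<nu>) * L ^ length \<nu>"
    proof -
      have "(real j + 1) / 2 + 1 = (real j + 3) / 2" by (simp add: field_simps)
      then have "pochhammer ((real j + 1) / 2) (Suc ?n) = (real j + 1) / 2 * pochhammer ((real j + 3) / 2) ?n"
        by (simp only: pochhammer_rec)
      then show ?thesis unfolding Cons Q_def by (simp add: mult_ac)
    qed
    finally show ?thesis .
  qed
qed

text \<open>This is the ball of radius \<open>K\<close> in the step of weight \<open>K\<close>. With
  one parameter for both, the balls with K \<ge> 1 increase and exhaust \<open>LC m\<close>.\<close>

definition sball :: "nat \<Rightarrow> real \<Rightarrow> 'k::real_normed_field ser set" where
  "sball m K = {c. wf_ser m c \<and> (\<forall>\<eta> i. norm (c \<eta> i) \<le> K ^ Suc (length \<eta>) * fact (length \<eta>))}"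

lemma sball_mono: "0 \<le> K \<Longrightarrow> K \<le> K' \<Longrightarrow> sball m K \<subseteq> sball m K'"
  unfolding sball_def by clarify (meson mult_right_mono order_trans power_mono fact_ge_zero)

lemma LC_iff: "c \<in> LC m \<longleftrightarrow> (\<exists>K\<ge>1. c \<in> sball m K)"
proof
  assume "c \<in> LC m"
  then obtain M B where M: "M > 0" and wf: "wf_ser m c"
    and B: "\<And>\<eta> i. norm (c \<eta> i) \<le> B * M ^ length \<eta> * fact (length \<eta>)"
    unfolding LC_def bounded_M_def by blast
  define K where "K = max 1 (max B M)"
  have "norm (c \<eta> i) \<le> K ^ Suc (length \<eta>) * fact (length \<eta>)" for \<eta> i
  proof -
    have "B * M ^ length \<eta> \<le> K * K ^ length \<eta>"
      unfolding K_def using M by (intro mult_mono power_mono) auto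
    then have "B * M ^ length \<eta> * fact (length \<eta>) \<le> K * K ^ length \<eta> * fact (length \<eta>)"
      by (rule mult_right_mono) simp
    then show ?thesis using B[of \<eta> i] by (simp only: power_Suc)
  qed
  with wf have "c \<in> sball m K" by (auto simp: sball_def)
  moreover have "1 \<le> K" by (simp add: K_def)
  ultimately show "\<exists>K\<ge>1. c \<in> sball m K" by blast
next
  assume "\<exists>K\<ge>1. c \<in> sball m K"
  then obtain K where K: "K \<ge> 1" "c \<in> sball m K" by blast
  then have "bounded_M K c" unfolding bounded_M_def sball_def by (intro exI[of _ K]) auto
  then show "c \<in> LC m" using K unfolding LC_def sball_def by (auto intro!: exI[of _ K])
qed

text \<open>This is the case j = 0. Since \<open>d\<close> is bounded only on shorter words,
  \<open>ginv_sball\<close> can apply it to the inverse itself inside an induction on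
  length.\<close>

lemma scomp_sball:
  assumes "1 \<le> K" "2 * K * (1 + real m * K) \<le> L" "c \<in> sball m K"
    and "\<And>\<eta> i. length \<eta> < length \<nu> \<Longrightarrow> norm (d \<eta> i) \<le> K * pochhammer (1/2) (length \<eta>) * L ^ length \<eta>"
  shows "norm (scomp m d (\<lambda>\<eta>. c \<eta> k) \<nu>) \<le> K * pochhammer (1/2) (length \<nu>) * L ^ length \<nu>"
  using norm_scomp_le[where K = K and m = m and L = L and d = d and c = "\<lambda>\<eta>. c \<eta> k" and j = 0
      and N = "length \<nu>" and \<nu> = \<nu>] assms
  by (auto simp: sball_def)

lemma gmult_sball:
  assumes K: "1 \<le> K" and c: "c \<in> sball m K" and d: "d \<in> sball m K"
  shows "gmult m c d \<in> sball m (2 * K * (1 + real m * K))"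
proof -
  define L where "L = 2 * K * (1 + real m * K)"
  have L: "2 * K \<le> L" using K unfolding L_def by simp
  \<comment> \<open>The factor 2 lost in \<open>fact_le_pochhammer_half\<close> is absorbed by 2 K
    \<le> L.\<close>
  have dK: "norm (d \<eta> i) \<le> K * pochhammer (1/2) (length \<eta>) * L ^ length \<eta>" for \<eta> i
  proof -
    let ?n = "length \<eta>"
    have "norm (d \<eta> i) \<le> K * (K ^ ?n * fact ?n)" using d unfolding sball_def by (simp add: mult.assoc)
    also have "\<dots> \<le> K * (K ^ ?n * (2 ^ ?n * pochhammer (1/2) ?n))"
      using K by (intro mult_left_mono fact_le_pochhammer_half) auto
    also have "\<dots> = K * pochhammer (1/2) ?n * (2 * K) ^ ?n" by (simp add: power_mult_distrib mult_ac)
    also have "\<dots> \<le> K * pochhammer (1/2) ?n * L ^ ?n"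
      using K L by (intro mult_left_mono power_mono) (auto intro!: mult_nonneg_nonneg pochhammer_nonneg)
    finally show ?thesis .
  qed
  have "norm (gmult m c d \<nu> k) \<le> L ^ Suc (length \<nu>) * fact (length \<nu>)" for \<nu> k
  proof -
    let ?n = "length \<nu>"
    have "norm (gmult m c d \<nu> k) \<le> norm (d \<nu> k) + norm (scomp m d (\<lambda>\<eta>. c \<eta> k) \<nu>)"
      unfolding gmult_def mixed_comp_eq by (simp add: norm_triangle_ineq)
    also have "\<dots> \<le> K * pochhammer (1/2) ?n * L ^ ?n + K * pochhammer (1/2) ?n * L ^ ?n"
      by (intro add_mono dK scomp_sball) (use K c L_def dK in auto)
    also have "\<dots> = 2 * K * (pochhammer (1/2) ?n * L ^ ?n)" by simp
    \<comment> \<open>Here 2 K \<le> L pays for the two summands.\<close>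
    also have "\<dots> \<le> L * (fact ?n * L ^ ?n)"
      using K L pochhammer_half_le_fact[of ?n]
      by (intro mult_mono mult_right_mono) (auto intro!: mult_nonneg_nonneg pochhammer_nonneg)
    finally show ?thesis by (simp add: mult_ac)
  qed
  moreover have "wf_ser m (gmult m c d)"
    using c d wf_ser_mixed_comp[of m c d] unfolding gmult_def by (auto simp: wf_ser_def sball_def)
  ultimately show ?thesis unfolding sball_def L_def by simp
qed

text \<open>The fixed point equation expresses a coefficient through the composition with the
  inverse on shorter words. There the majorant K P reproduces itself, so nothing is lost from one
  length to the next.\<close>

lemma ginv_sball:
  assumes K: "1 \<le> K" and c: "c \<in> sball m K"
  shows "ginv m c \<in> sball m (2 * K * (1 + real m * K))"
proof -
  define L where "L = 2 * K * (1 + real m * K)"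
  have L: "2 * K \<le> L" using K unfolding L_def by simp
  have *: "norm (ginv m c \<nu> k) \<le> K * pochhammer (1/2) (length \<nu>) * L ^ length \<nu>" for \<nu> k
  proof (induction "length \<nu>" arbitrary: \<nu> k rule: less_induct)
    case less
    show ?case
      unfolding ginv_fixpoint[of m c \<nu>] norm_minus_cancel
      by (rule scomp_sball[OF K eq_refl[OF L_def[symmetric]] c]) (rule less.hyps)
  qed
  have "norm (ginv m c \<nu> k) \<le> L ^ Suc (length \<nu>) * fact (length \<nu>)" for \<nu> k
  proof -
    have "K * (pochhammer (1/2) (length \<nu>) * L ^ length \<nu>) \<le> L * (fact (length \<nu>) * L ^ length \<nu>)"
      using K L pochhammer_half_le_fact[of "length \<nu>"]
      by (intro mult_mono mult_right_mono) (auto intro!: mult_nonneg_nonneg pochhammer_nonneg)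
    then show ?thesis using *[of \<nu> k] by (simp add: mult_ac)
  qed
  then show ?thesis using c wf_ser_ginv[of m c] unfolding sball_def L_def by simp
qed

lemma bound_ge_1: "1 \<le> K \<Longrightarrow> 1 \<le> 2 * K * (1 + real m * K)"
  by (smt (verit) mult_nonneg_nonneg mult_le_cancel_left1 of_nat_0_le_iff)

lemma gmult_LC:
  assumes "c \<in> LC m" "d \<in> LC m" shows "gmult m c d \<in> LC m"
proof -
  obtain K1 K2 where *: "1 \<le> K1" "c \<in> sball m K1" "1 \<le> K2" "d \<in> sball m K2"
    using assms unfolding LC_iff by blast
  then have "c \<in> sball m (max K1 K2)" "d \<in> sball m (max K1 K2)" "1 \<le> max K1 K2"
    using sball_mono[of K1 "max K1 K2" m] sball_mono[of K2 "max K1 K2" m] by auto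
  then show ?thesis unfolding LC_iff using gmult_sball bound_ge_1 by blast
qed

lemma ginv_LC: "c \<in> LC m \<Longrightarrow> ginv m c \<in> LC m"
  unfolding LC_iff using ginv_sball bound_ge_1 by blast

lemma zero_LC: "0 \<in> LC m"
  unfolding LC_iff by (intro exI[of _ 1]) (auto simp: sball_def wf_ser_def)

lemma LC_wf: "c \<in> LC m \<Longrightarrow> wf_ser m c"
  by (simp add: LC_def)

text \<open>\<open>gmult_ginv\<close> gives right inverses only. As in any monoid with right
  inverses, the right inverse of \<open>ginv m c\<close> turns out to be \<open>c\<close>.\<close>

lemma ginv_gmult:
  assumes "c \<in> LC m" shows "gmult m (ginv m c) c = 0"
proof -
  let ?y = "ginv m c" let ?z = "ginv m ?y"
  have "c = gmult m c (gmult m ?y ?z)"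
    using assms by (simp add: gmult_ginv gmult_0_right LC_wf)
  also have "\<dots> = gmult m (gmult m c ?y) ?z" by (simp add: gmult_assoc)
  also have "\<dots> = ?z" by (simp add: gmult_ginv gmult_0_left)
  finally show ?thesis using gmult_ginv[of m ?y] by simp
qed

lemma group_Fliess: "group (Fliess_group m :: 'k::real_normed_field ser monoid)"
  unfolding Fliess_group_def
proof (rule groupI; simp)
  fix c :: "'k ser" assume "c \<in> LC m"
  then show "\<exists>y\<in>LC m. gmult m y c = 0" using ginv_gmult ginv_LC by blast
qed (auto simp: gmult_LC zero_LC gmult_assoc gmult_0_left)

lemma m_inv_Fliess: "c \<in> LC m \<Longrightarrow> m_inv (Fliess_group m) c = ginv m c"
  by (rule group.inv_equality[OF group_Fliess])
     (auto simp: Fliess_group_def ginv_gmult ginv_LC)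

section \<open>The Silva topology\<close>

lemma sball_add:
  assumes "c \<in> sball m K" "d \<in> sball m K'" "0 \<le> K" "0 \<le> K'"
  shows "c + d \<in> sball m (K + K')"
proof -
  have "norm ((c + d) \<eta> i) \<le> (K + K') ^ Suc (length \<eta>) * fact (length \<eta>)" for \<eta> i
  proof -
    have "norm ((c + d) \<eta> i) \<le> norm (c \<eta> i) + norm (d \<eta> i)" by (simp add: norm_triangle_ineq)
    also have "\<dots> \<le> (K * K ^ length \<eta> + K' * K' ^ length \<eta>) * fact (length \<eta>)"
      using assms unfolding sball_def distrib_right by (intro add_mono) auto
    also have "\<dots> \<le> (K * (K + K') ^ length \<eta> + K' * (K + K') ^ length \<eta>) * fact (length \<eta>)"
      using assms by (intro mult_right_mono add_mono mult_left_mono power_mono) auto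
    finally show ?thesis by (simp add: distrib_right)
  qed
  then show ?thesis using assms by (auto simp: sball_def wf_ser_def)
qed

lemma sball_scale:
  assumes "c \<in> sball m K" "norm t \<le> 1"
  shows "ser_scale t c \<in> sball m K"
proof -
  have "norm (ser_scale t c \<eta> i) \<le> K ^ Suc (length \<eta>) * fact (length \<eta>)" for \<eta> i
  proof -
    have "norm (ser_scale t c \<eta> i) \<le> 1 * norm (c \<eta> i)"
      unfolding ser_scale_def norm_mult using assms by (intro mult_right_mono) auto
    also have "\<dots> \<le> K ^ Suc (length \<eta>) * fact (length \<eta>)"
      using assms unfolding sball_def by simp
    finally show ?thesis .
  qed
  then show ?thesis using assms by (auto simp: sball_def wf_ser_def ser_scale_def)
qed

lemma absconvD:
  "absconv V \<Longrightarrow> a \<in> V \<Longrightarrow> b \<in> V \<Longrightarrow> norm s + norm t \<le> 1 \<Longrightarrow> (\<lambda>\<eta> i. s * a \<eta> i + t * b \<eta> i) \<in> V"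
  unfolding absconv_def by blast

lemma LC_I:
  "M > 0 \<Longrightarrow> wf_ser m c \<Longrightarrow> (\<And>\<eta> i. norm (c \<eta> i) \<le> B * M ^ length \<eta> * fact (length \<eta>)) \<Longrightarrow> c \<in> LC m"
  unfolding LC_def bounded_M_def by blast

lemma LC_lincomb:
  assumes "c \<in> LC m" "d \<in> LC m"
  shows "(\<lambda>\<eta> i. s * c \<eta> i + t * d \<eta> i) \<in> LC m"
proof -
  obtain K1 K2 where K: "1 \<le> K1" "c \<in> sball m K1" "1 \<le> K2" "d \<in> sball m K2"
    using assms unfolding LC_iff by blast
  define K where "K = (norm s + norm t) * (K1 + K2) + (K1 + K2)"
  have le: "K1 \<le> K" "K2 \<le> K" using K unfolding K_def
    by (smt (verit) mult_nonneg_nonneg norm_ge_zero)+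
  have "norm (s * c \<eta> i + t * d \<eta> i) \<le> K * K ^ length \<eta> * fact (length \<eta>)" for \<eta> i
  proof -
    let ?n = "length \<eta>"
    have "norm (s * c \<eta> i + t * d \<eta> i) \<le> norm s * norm (c \<eta> i) + norm t * norm (d \<eta> i)"
      by (metis norm_mult norm_triangle_ineq)
    also have "\<dots> \<le> norm s * (K1 * K1 ^ ?n * fact ?n) + norm t * (K2 * K2 ^ ?n * fact ?n)"
      using K unfolding sball_def by (intro add_mono mult_left_mono) auto
    also have "\<dots> \<le> norm s * ((K1 + K2) * K ^ ?n * fact ?n) + norm t * ((K1 + K2) * K ^ ?n * fact ?n)"
      using K le by (intro add_mono mult_left_mono mult_right_mono mult_mono power_mono) auto
    also have "\<dots> = ((norm s + norm t) * (K1 + K2)) * (K ^ ?n * fact ?n)"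
      by (simp add: algebra_simps)
    also have "\<dots> \<le> K * (K ^ ?n * fact ?n)"
      using K le unfolding K_def by (intro mult_right_mono) auto
    finally show ?thesis by (simp add: mult.assoc)
  qed
  then have "(\<lambda>\<eta> i. s * c \<eta> i + t * d \<eta> i) \<in> sball m K"
    using K by (auto simp: sball_def wf_ser_def)
  moreover have "1 \<le> K" using K le by simp
  ultimately show ?thesis unfolding LC_iff by blast
qed

lemma LC_add: "c \<in> LC m \<Longrightarrow> d \<in> LC m \<Longrightarrow> c + d \<in> LC m"
  using LC_lincomb[of c m d 1 1] by (simp add: plus_fun_def)

lemma LC_scale: "c \<in> LC m \<Longrightarrow> ser_scale t c \<in> LC m"
  using LC_lincomb[of c m c t 0] by (simp add: ser_scale_def)

lemma openin_silva: "openin (silva_top m) U \<longleftrightarrow> silva_open m U"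
  unfolding silva_top_def by (simp add: istopology_silva_open)

lemma silva_nbhd0_LC: "silva_nbhd0 m (LC m)"
  unfolding silva_nbhd0_def absconv_def
proof (intro conjI allI impI ballI)
  fix M :: real assume "M > 0"
  then show "\<exists>\<epsilon>>0. \<forall>c. wf_ser m c \<and> (\<forall>\<eta> i. norm (c \<eta> i) \<le> \<epsilon> * M ^ length \<eta> * fact (length \<eta>)) \<longrightarrow> c \<in> LC m"
    by (intro exI[of _ 1]) (auto intro: LC_I[of M _ _ 1])
qed (auto intro: LC_lincomb)

lemma topspace_silva [simp]: "topspace (silva_top m) = LC m"
proof (rule equalityI)
  show "topspace (silva_top m) \<subseteq> LC m"
    unfolding topspace_def openin_silva silva_open_def by blast
  have "silva_open m (LC m)"
    unfolding silva_open_def using silva_nbhd0_LC LC_add by blast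
  then show "LC m \<subseteq> topspace (silva_top m)"
    using openin_subset openin_silva by blast
qed

lemma silva_nbhd0_contains_0: "silva_nbhd0 m V \<Longrightarrow> 0 \<in> V"
proof -
  assume "silva_nbhd0 m V"
  then obtain e where "e > 0" and e: "\<And>c. wf_ser m c \<Longrightarrow>
      (\<And>\<eta> i. norm (c \<eta> i) \<le> e * 1 ^ length \<eta> * fact (length \<eta>)) \<Longrightarrow> c \<in> V"
    unfolding silva_nbhd0_def by (metis zero_less_one)
  then show "0 \<in> V" by (intro e) (auto simp: wf_ser_def)
qed

text \<open>By absolute convexity, the sum of two elements of this half of \<open>V\<close> lies in
  \<open>V\<close>; \<open>silva_nbhd_interior\<close> needs this room.\<close>

lemma silva_nbhd0_half:
  assumes V: "silva_nbhd0 m V"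
  shows "silva_nbhd0 m {v. ser_scale 2 v \<in> V}"
  unfolding silva_nbhd0_def
proof (intro conjI allI impI)
  have half: "ser_scale (1/2) (ser_scale 2 v) = v" for v :: "'a ser"
    by (simp add: ser_scale_def)
  show "{v. ser_scale 2 v \<in> V} \<subseteq> LC m"
  proof
    fix v assume "v \<in> {v. ser_scale 2 v \<in> V}"
    then have "ser_scale 2 v \<in> LC m" using V unfolding silva_nbhd0_def by blast
    then show "v \<in> LC m" using LC_scale[of "ser_scale 2 v" m "1/2"] half by simp
  qed
  have lin: "ser_scale 2 (\<lambda>\<eta> i. s * a \<eta> i + t * b \<eta> i) =
     (\<lambda>\<eta> i. s * ser_scale 2 a \<eta> i + t * ser_scale 2 b \<eta> i)" for s t and a b :: "'a ser"
    by (simp add: ser_scale_def algebra_simps)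
  show "absconv {v. ser_scale 2 v \<in> V}"
    using V unfolding silva_nbhd0_def absconv_def mem_Collect_eq lin by blast
next
  fix M :: real assume "M > 0"
  then obtain e where e: "e > 0" "\<And>c. wf_ser m c \<Longrightarrow>
      (\<And>\<eta> i. norm (c \<eta> i) \<le> e * M ^ length \<eta> * fact (length \<eta>)) \<Longrightarrow> c \<in> V"
    using V unfolding silva_nbhd0_def by metis
  show "\<exists>\<epsilon>>0. \<forall>c. wf_ser m c \<and> (\<forall>\<eta> i. norm (c \<eta> i) \<le> \<epsilon> * M ^ length \<eta> * fact (length \<eta>)) \<longrightarrow>
     c \<in> {v. ser_scale 2 v \<in> V}"
  proof (intro exI[of _ "e / 2"] conjI allI impI CollectI)
    fix c :: "'a ser"
    assume c: "wf_ser m c \<and> (\<forall>\<eta> i. norm (c \<eta> i) \<le> e / 2 * M ^ length \<eta> * fact (length \<eta>))"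
    show "ser_scale 2 c \<in> V"
    proof (rule e(2))
      show "wf_ser m (ser_scale 2 c)" using c by (auto simp: wf_ser_def ser_scale_def)
      fix \<eta> i show "norm (ser_scale 2 c \<eta> i) \<le> e * M ^ length \<eta> * fact (length \<eta>)"
        using c[THEN conjunct2, rule_format, of \<eta> i] by (simp add: ser_scale_def norm_mult)
    qed
  qed (use e in auto)
qed

text \<open>A \<open>silva_nbhd0\<close> set need not be open, so \<open>U\<close> is the interior
  of x + V. If y + W lies in x + V, moving \<open>y\<close> by half of \<open>W\<close> leaves the
  other half of \<open>W\<close> as a neighbourhood.\<close>

lemma silva_nbhd_interior:
  assumes "x \<in> LC m" and V: "silva_nbhd0 m V"
  obtains U where "openin (silva_top m) U" "x \<in> U" "\<And>y. y \<in> U \<Longrightarrow> y - x \<in> V"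
proof
  define U where "U = {y. \<exists>W. silva_nbhd0 m W \<and> (\<lambda>v. y + v) ` W \<subseteq> (\<lambda>v. x + v) ` V}"
  show inV: "y - x \<in> V" if yU: "y \<in> U" for y
  proof -
    obtain W where W: "silva_nbhd0 m W" "(\<lambda>v. y + v) ` W \<subseteq> (\<lambda>v. x + v) ` V"
      using yU unfolding U_def by blast
    then have "y + 0 \<in> (\<lambda>v. x + v) ` V" using silva_nbhd0_contains_0 by blast
    then show ?thesis by auto
  qed
  show "x \<in> U" using V unfolding U_def by blast
  show "openin (silva_top m) U"
    unfolding openin_silva silva_open_def
  proof (intro conjI ballI subsetI)
    fix y assume "y \<in> U"
    then have "y - x \<in> LC m" using inV V unfolding silva_nbhd0_def by blast
    then have "x + (y - x) \<in> LC m" using assms LC_add by blast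
    then show "y \<in> LC m" by simp
  next
    fix y assume "y \<in> U"
    then obtain W where W: "silva_nbhd0 m W" "(\<lambda>v. y + v) ` W \<subseteq> (\<lambda>v. x + v) ` V"
      unfolding U_def by blast
    let ?H = "{v. ser_scale 2 v \<in> W}"
    have "y + v \<in> U" if "v \<in> ?H" for v
      unfolding U_def
    proof (intro CollectI exI conjI)
      show "silva_nbhd0 m ?H" by (rule silva_nbhd0_half[OF W(1)])
      show "(\<lambda>v'. (y + v) + v') ` ?H \<subseteq> (\<lambda>v. x + v) ` V"
      proof
        fix z assume "z \<in> (\<lambda>v'. (y + v) + v') ` ?H"
        then obtain v' where v': "ser_scale 2 v' \<in> W" "z = (y + v) + v'" by blast
        have "(\<lambda>\<eta> i. (1/2) * ser_scale 2 v \<eta> i + (1/2) * ser_scale 2 v' \<eta> i) \<in> W"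
          using W(1) that v' unfolding silva_nbhd0_def
          by (intro absconvD) (auto simp: norm_divide)
        also have "(\<lambda>\<eta> i. (1/2) * ser_scale 2 v \<eta> i + (1/2) * ser_scale 2 v' \<eta> i) = v + v'"
          by (auto simp: ser_scale_def fun_eq_iff)
        finally have "y + (v + v') \<in> (\<lambda>v. x + v) ` V" using W(2) by blast
        then show "z \<in> (\<lambda>v. x + v) ` V" using v' by (simp add: add.assoc)
      qed
    qed
    then show "\<exists>V. silva_nbhd0 m V \<and> (\<lambda>v. y + v) ` V \<subseteq> U"
      using silva_nbhd0_half[OF W(1)] by blast
  qed
qed

lemma openin_silva_nbhd:
  assumes "openin (silva_top m) U" "x \<in> U"
  obtains V where "silva_nbhd0 m V" "\<And>y. y - x \<in> V \<Longrightarrow> y \<in> U"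
proof -
  obtain V where V: "silva_nbhd0 m V" "(\<lambda>v. x + v) ` V \<subseteq> U"
    using assms unfolding openin_silva silva_open_def by blast
  have "y \<in> U" if "y - x \<in> V" for y
  proof -
    have "x + (y - x) \<in> U" using that V by blast
    then show ?thesis by simp
  qed
  then show ?thesis using that V by blast
qed

lemma limitin_silvaI:
  assumes "l \<in> LC m" "\<And>V. silva_nbhd0 m V \<Longrightarrow> \<forall>\<^sub>F t in F. f t - l \<in> V"
  shows "limitin (silva_top m) f l F"
  unfolding limitin_def
proof (intro conjI allI impI)
  fix U assume "openin (silva_top m) U \<and> l \<in> U"
  then obtain V where "silva_nbhd0 m V" "\<And>y. y - l \<in> V \<Longrightarrow> y \<in> U"
    using openin_silva_nbhd[of m U l] by blast
  then show "\<forall>\<^sub>F t in F. f t \<in> U" by (metis (no_types, lifting) assms(2) eventually_mono)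
qed (simp add: assms)

text \<open>Coefficient functionals are continuous, and they separate points. So limits are unique,
  and \<open>THE\<close> in \<open>bderiv\<close> picks the intended one.\<close>

lemma silva_nbhd0_coefficient:
  assumes "e > 0"
  shows "silva_nbhd0 m {c \<in> LC m. norm (c \<eta> i) \<le> e}"
  unfolding silva_nbhd0_def absconv_def
proof (intro conjI allI impI ballI)
  fix a b :: "'a ser" and s t :: 'a
  assume a: "a \<in> {c \<in> LC m. norm (c \<eta> i) \<le> e}" and b: "b \<in> {c \<in> LC m. norm (c \<eta> i) \<le> e}"
    and st: "norm s + norm t \<le> 1"
  have "norm (s * a \<eta> i + t * b \<eta> i) \<le> norm s * norm (a \<eta> i) + norm t * norm (b \<eta> i)"
    by (metis norm_mult norm_triangle_ineq)
  also have "\<dots> \<le> norm s * e + norm t * e" using a b by (intro add_mono mult_left_mono) auto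
  also have "\<dots> = (norm s + norm t) * e" by (simp add: algebra_simps)
  also have "\<dots> \<le> 1 * e" using st assms by (intro mult_right_mono) auto
  finally show "(\<lambda>\<eta> i. s * a \<eta> i + t * b \<eta> i) \<in> {c \<in> LC m. norm (c \<eta> i) \<le> e}"
    using a b by (simp add: LC_lincomb)
next
  fix M :: real assume M: "M > 0"
  let ?w = "M ^ length \<eta> * fact (length \<eta>)"
  have w: "?w > 0" using M by simp
  show "\<exists>\<epsilon>>0. \<forall>c::'a ser. wf_ser m c \<and> (\<forall>\<eta> i. norm (c \<eta> i) \<le> \<epsilon> * M ^ length \<eta> * fact (length \<eta>)) \<longrightarrow>
      c \<in> {c \<in> LC m. norm (c \<eta> i) \<le> e}"
  proof (intro exI[of _ "e / ?w"] conjI allI impI)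
    fix c :: "'a ser"
    assume c: "wf_ser m c \<and> (\<forall>\<eta>' i. norm (c \<eta>' i) \<le> e / ?w * M ^ length \<eta>' * fact (length \<eta>'))"
    have "norm (c \<eta> i) \<le> e / ?w * ?w" using c by (metis mult.assoc)
    moreover have "e / ?w * ?w = e" using M by simp
    ultimately have "norm (c \<eta> i) \<le> e" by simp
    moreover have "c \<in> LC m" using M c LC_I[of M m c "e / ?w"] by blast
    ultimately show "c \<in> {c \<in> LC m. norm (c \<eta> i) \<le> e}" by blast
  qed (use w assms in auto)
qed auto

lemma limitin_silva_coefficient:
  assumes "limitin (silva_top m) f l F"
  shows "((\<lambda>t. f t \<eta> i) \<longlongrightarrow> l \<eta> i) F"
proof (rule tendstoI)
  fix e :: real assume e: "e > 0"
  have l: "l \<in> LC m" using assms by (simp add: limitin_def)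
  have V: "silva_nbhd0 m {c \<in> LC m. norm (c \<eta> i) \<le> e / 2}"
    by (rule silva_nbhd0_coefficient) (use e in simp)
  obtain U where U: "openin (silva_top m) U" "l \<in> U"
     "\<And>y. y \<in> U \<Longrightarrow> y - l \<in> {c \<in> LC m. norm (c \<eta> i) \<le> e / 2}"
    by (rule silva_nbhd_interior[OF l V]) blast
  have "\<forall>\<^sub>F t in F. f t \<in> U" using assms U unfolding limitin_def by blast
  then show "\<forall>\<^sub>F t in F. dist (f t \<eta> i) (l \<eta> i) < e"
  proof (rule eventually_mono)
    fix t assume "f t \<in> U"
    then show "dist (f t \<eta> i) (l \<eta> i) < e" using U(3)[of "f t"] e by (simp add: dist_norm)
  qed
qed

lemma limitin_silva_unique:
  assumes "limitin (silva_top m) f l F" "limitin (silva_top m) f l' F" "F \<noteq> bot"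
  shows "l = l'"
proof (intro ext)
  fix \<eta> i
  show "l \<eta> i = l' \<eta> i"
    using tendsto_unique[OF assms(3) limitin_silva_coefficient[OF assms(1)] limitin_silva_coefficient[OF assms(2)]] .
qed

text \<open>On a norm ball of one step, the Silva topology is that of coefficientwise convergence.\<close>
lemma sball_small_in_nbhd0:
  assumes V: "silva_nbhd0 m V" and K: "1 \<le> K"
  obtains N e where "e > 0"
    "\<And>c. c \<in> sball m K \<Longrightarrow> (\<And>\<eta> i. length \<eta> \<le> N \<Longrightarrow> norm (c \<eta> i) \<le> e) \<Longrightarrow> c \<in> V"
proof -
  \<comment> \<open>In the step of weight 2 K the elements of the ball are of relative size at most
    K / 2 ^ n, so beyond some length they are small automatically.\<close>
  have "2 * K > 0" using K by simp
  then obtain e where e: "e > 0" "\<And>c. wf_ser m c \<Longrightarrow>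
      (\<And>\<eta> i. norm (c \<eta> i) \<le> e * (2 * K) ^ length \<eta> * fact (length \<eta>)) \<Longrightarrow> c \<in> V"
    using V unfolding silva_nbhd0_def by metis
  obtain N where N: "K / e < 2 ^ N" using real_arch_pow[of 2 "K / e"] by auto
  show ?thesis
  proof (rule that[OF e(1), of N])
    fix c :: "'a ser"
    assume c: "c \<in> sball m K" and small: "\<And>\<eta> i. length \<eta> \<le> N \<Longrightarrow> norm (c \<eta> i) \<le> e"
    show "c \<in> V"
    proof (rule e(2))
      show "wf_ser m c" using c by (simp add: sball_def)
      fix \<eta> :: "nat list" and i
      let ?n = "length \<eta>"
      show "norm (c \<eta> i) \<le> e * (2 * K) ^ ?n * fact ?n"
      proof (cases "?n \<le> N")
        case True
        have "1 \<le> (2 * K) ^ ?n" using K by (intro one_le_power) auto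
        then have "1 * 1 \<le> (2 * K) ^ ?n * (fact ?n :: real)" by (intro mult_mono) auto
        then have "e * 1 \<le> e * ((2 * K) ^ ?n * fact ?n)" using e by (intro mult_left_mono) auto
        then show ?thesis using small[OF True, of i] by (simp add: mult.assoc)
      next
        case False
        then have "(2::real) ^ N \<le> 2 ^ ?n" by (intro power_increasing) auto
        then have "K / e \<le> 2 ^ ?n" using N by linarith
        then have "K \<le> e * 2 ^ ?n" using e by (simp add: divide_le_eq mult.commute)
        have "norm (c \<eta> i) \<le> K * (K ^ ?n * fact ?n)"
          using c by (simp add: sball_def mult.assoc)
        also have "\<dots> \<le> (e * 2 ^ ?n) * (K ^ ?n * fact ?n)"
          using K \<open>K \<le> e * 2 ^ ?n\<close> by (intro mult_right_mono) auto
        also have "\<dots> = e * (2 * K) ^ ?n * fact ?n"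
          by (simp add: power_mult_distrib)
        finally show ?thesis .
      qed
    qed
  qed
qed

lemma eventually_in_nbhd0:
  assumes V: "silva_nbhd0 m V" and K: "1 \<le> K" and c: "\<And>p. c p \<in> sball m K"
    and lim: "\<And>\<eta> i. ((\<lambda>p. c p \<eta> i) \<longlongrightarrow> 0) F"
  shows "\<forall>\<^sub>F p in F. c p \<in> V"
proof -
  obtain N e where e: "e > 0"
    "\<And>c. c \<in> sball m K \<Longrightarrow> (\<And>\<eta> i. length \<eta> \<le> N \<Longrightarrow> norm (c \<eta> i) \<le> e) \<Longrightarrow> c \<in> V"
    using sball_small_in_nbhd0[OF V K] by metis
  have "\<forall>\<^sub>F p in F. norm (c p \<eta> i) < e" for \<eta> i
    using lim[of \<eta> i] e(1) unfolding tendsto_iff dist_norm by simp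
  \<comment> \<open>The support condition leaves finitely many coefficients of length at most
    \<open>N\<close>, so the eventual bounds hold simultaneously.\<close>
  then have "\<forall>\<^sub>F p in F. \<forall>x\<in>words m N \<times> {1..m}. norm (c p (fst x) (snd x)) < e"
    by (intro eventually_ball_finite) (auto simp: finite_words)
  then show ?thesis
  proof (rule eventually_mono)
    fix p assume p: "\<forall>x\<in>words m N \<times> {1..m}. norm (c p (fst x) (snd x)) < e"
    show "c p \<in> V"
    proof (rule e(2)[OF c])
      fix \<eta> :: "nat list" and i assume len: "length \<eta> \<le> N"
      show "norm (c p \<eta> i) \<le> e"
      proof (cases "set \<eta> \<subseteq> {0..m} \<and> i \<in> {1..m}")
        case True
        then have "(\<eta>, i) \<in> words m N \<times> {1..m}" using len by (simp add: words_def)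
        then show ?thesis using bspec[OF p, of "(\<eta>, i)"] by simp
      next
        case False
        then have "c p \<eta> i = 0" using c[of p] unfolding sball_def wf_ser_def by blast
        then show ?thesis using e by simp
      qed
    qed
  qed
qed

section \<open>Openness on balls and polynomial coefficients\<close>

text \<open>Tychonoff makes the product of discs compact; as the index type is countable, the
  product is first countable, so compactness yields convergent subsequences.\<close>

lemma pointwise_bounded_convergent_subseq:
  fixes y :: "nat \<Rightarrow> 'i::countable \<Rightarrow> complex"
  assumes "\<And>p i. norm (y p i) \<le> B i"
  obtains r l where "strict_mono r" "\<And>i. (\<lambda>p. y (r p) i) \<longlonglongrightarrow> l i"
proof -
  have "compactin (product_topology (\<lambda>_. euclidean) UNIV) (PiE UNIV (\<lambda>i. cball (0::complex) (B i)))"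
    by (subst compactin_PiE) (auto simp: compactin_euclidean_iff)
  then have "compact (PiE UNIV (\<lambda>i. cball (0::complex) (B i)))"
    by (simp add: euclidean_product_topology compactin_euclidean_iff)
  then have "seq_compact (PiE UNIV (\<lambda>i. cball (0::complex) (B i)))"
    by (rule compact_imp_seq_compact)
  moreover have "y p \<in> PiE UNIV (\<lambda>i. cball 0 (B i))" for p
    using assms by (auto simp: PiE_UNIV_domain)
  ultimately obtain l r where r: "strict_mono r" "(y \<circ> r) \<longlonglongrightarrow> l"
    unfolding seq_compact_def by metis
  have "(\<lambda>p. y (r p) i) \<longlonglongrightarrow> l i" for i
  proof -
    have "continuous_on UNIV (\<lambda>x::'i \<Rightarrow> complex. x i)" by simp
    then have "isCont (\<lambda>x::'i \<Rightarrow> complex. x i) l"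
      by (simp only: continuous_on_eq_continuous_at[OF open_UNIV] UNIV_I ball_UNIV)
    from isCont_tendsto_compose[OF this r(2)] show ?thesis by (simp add: o_def)
  qed
  then show ?thesis using that r(1) by blast
qed

lemma pointwise_bounded_convergent_subseq_ser:
  fixes u :: "nat \<Rightarrow> 'a::countable \<Rightarrow> complex ser"
  assumes "\<And>p a \<eta> i. norm (u p a \<eta> i) \<le> B \<eta>"
  obtains r l where "strict_mono r" "\<And>a \<eta> i. (\<lambda>p. u (r p) a \<eta> i) \<longlonglongrightarrow> l a \<eta> i"
proof -
  obtain r l where r: "strict_mono r"
    and l: "\<And>x. (\<lambda>p. (\<lambda>(a, \<eta>, i). u (r p) a \<eta> i) x) \<longlonglongrightarrow> l x"
    by (rule pointwise_bounded_convergent_subseq[of "\<lambda>p (a, \<eta>, i). u p a \<eta> i" "\<lambda>(a, \<eta>, i). B \<eta>"])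
       (auto simp: assms)
  show ?thesis
  proof (rule that[OF r, of "\<lambda>a \<eta> i. l (a, \<eta>, i)"])
    fix a \<eta> i show "(\<lambda>p. u (r p) a \<eta> i) \<longlonglongrightarrow> l (a, \<eta>, i)" using l[of "(a, \<eta>, i)"] by simp
  qed
qed

text \<open>The weight is arbitrary because the boxes below are enlarged by taking maxima, and these
  leave the family of weights K ^ (n + 1) n!.\<close>

definition ser_box :: "nat \<Rightarrow> (nat \<Rightarrow> real) \<Rightarrow> 'k::real_normed_field ser set" where
  "ser_box m v = {c. wf_ser m c \<and> (\<forall>\<eta> i. norm (c \<eta> i) \<le> v (length \<eta>))}"

lemma ser_box_mono: "(\<And>n. v n \<le> w n) \<Longrightarrow> ser_box m v \<subseteq> ser_box m w"
  unfolding ser_box_def using order_trans by blast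

lemma ser_box_sball: "(\<And>n. v n \<le> K ^ Suc n * fact n) \<Longrightarrow> ser_box m v \<subseteq> sball m K"
  unfolding ser_box_def sball_def using order_trans by blast

lemma absconv_ser_box: "absconv (ser_box m v)"
  unfolding absconv_def
proof (intro ballI allI impI)
  fix a b :: "'a ser" and s t :: 'a
  assume a: "a \<in> ser_box m v" and b: "b \<in> ser_box m v" and st: "norm s + norm t \<le> 1"
  have "norm (s * a \<eta> i + t * b \<eta> i) \<le> v (length \<eta>)" for \<eta> i
  proof -
    have "norm (a \<eta> i) \<le> v (length \<eta>)" using a by (simp add: ser_box_def)
    then have "0 \<le> v (length \<eta>)" by (rule order_trans[OF norm_ge_zero])
    have "norm (s * a \<eta> i + t * b \<eta> i) \<le> norm s * norm (a \<eta> i) + norm t * norm (b \<eta> i)"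
      by (metis norm_mult norm_triangle_ineq)
    also have "\<dots> \<le> norm s * v (length \<eta>) + norm t * v (length \<eta>)"
      using a b unfolding ser_box_def by (intro add_mono mult_left_mono) auto
    also have "\<dots> = (norm s + norm t) * v (length \<eta>)" by (simp add: algebra_simps)
    also have "\<dots> \<le> 1 * v (length \<eta>)" using st \<open>0 \<le> v (length \<eta>)\<close> by (intro mult_right_mono) auto
    finally show ?thesis by simp
  qed
  then show "(\<lambda>\<eta> i. s * a \<eta> i + t * b \<eta> i) \<in> ser_box m v"
    using a b by (auto simp: ser_box_def wf_ser_def)
qed

text \<open>An increasing union of absolutely convex sets is absolutely convex, and the box with
  index \<open>Suc j\<close> contains a ball of the step of weight \<open>Suc j\<close>, so every
  step is reached.\<close>

lemma silva_nbhd0_Union_ser_box: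
  assumes incseq: "\<And>j n. v j n \<le> v (Suc j) n"
    and exp: "\<And>j. \<exists>K\<ge>1. \<forall>n. v j n \<le> K ^ Suc n * fact n"
    and ball: "\<And>j. \<exists>e>0. \<forall>n. e * real (Suc j) ^ n * fact n \<le> v (Suc j) n"
  shows "silva_nbhd0 m (\<Union>j. ser_box m (v j) :: 'k::real_normed_field ser set)"
  unfolding silva_nbhd0_def
proof (intro conjI allI impI)
  have mono: "v j n \<le> v k n" if "j \<le> k" for j k n
    by (rule lift_Suc_mono_le[of "\<lambda>j. v j n", OF incseq that])
  show "(\<Union>j. ser_box m (v j) :: 'k ser set) \<subseteq> LC m"
    using exp ser_box_sball[of "v j" for j] unfolding LC_iff subset_iff by fast
  show "absconv (\<Union>j. ser_box m (v j) :: 'k ser set)"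
    unfolding absconv_def
  proof (intro ballI allI impI)
    fix a b :: "'k ser" and s t :: 'k
    assume "a \<in> (\<Union>j. ser_box m (v j))" "b \<in> (\<Union>j. ser_box m (v j))" and st: "norm s + norm t \<le> 1"
    then obtain j k where "a \<in> ser_box m (v j)" "b \<in> ser_box m (v k)" by blast
    then have "a \<in> ser_box m (v (max j k))" "b \<in> ser_box m (v (max j k))"
      using ser_box_mono[of "v j" "v (max j k)" m] ser_box_mono[of "v k" "v (max j k)" m] mono by auto
    then have "(\<lambda>\<eta> i. s * a \<eta> i + t * b \<eta> i) \<in> ser_box m (v (max j k))"
      by (rule absconvD[OF absconv_ser_box]) (rule st)
    then show "(\<lambda>\<eta> i. s * a \<eta> i + t * b \<eta> i) \<in> (\<Union>j. ser_box m (v j))" by blast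
  qed
next
  fix M :: real assume M: "M > 0"
  define j where "j = nat \<lceil>M\<rceil>"
  obtain e where e: "e > 0" "\<And>n. e * real (Suc j) ^ n * fact n \<le> v (Suc j) n" using ball by blast
  show "\<exists>\<epsilon>>0. \<forall>c::'k ser. wf_ser m c \<and> (\<forall>\<eta> i. norm (c \<eta> i) \<le> \<epsilon> * M ^ length \<eta> * fact (length \<eta>)) \<longrightarrow>
     c \<in> (\<Union>j. ser_box m (v j))"
  proof (intro exI[of _ e] conjI allI impI)
    fix c :: "'k ser"
    assume c: "wf_ser m c \<and> (\<forall>\<eta> i. norm (c \<eta> i) \<le> e * M ^ length \<eta> * fact (length \<eta>))"
    have "norm (c \<eta> i) \<le> v (Suc j) (length \<eta>)" for \<eta> i
    proof -
      have "M \<le> real (Suc j)" unfolding j_def by linarith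
      then have "e * M ^ length \<eta> * fact (length \<eta>) \<le> e * real (Suc j) ^ length \<eta> * fact (length \<eta>)"
        using e M by (intro mult_right_mono mult_left_mono power_mono) auto
      then show ?thesis using c e(2)[of "length \<eta>"] by (meson order_trans)
    qed
    then show "c \<in> (\<Union>j. ser_box m (v j))" using c unfolding ser_box_def by blast
  qed (rule e)
qed

text \<open>A set that meets every norm ball of the steps in a relatively open set is open in the Silva
  topology. The neighbourhood is an increasing union of boxes, each compact for coefficientwise
  convergence, which allows to enlarge them one step at a time.\<close>
lemma silva_nbhd0_of_ball_condition:
  fixes Q :: "('a::countable \<Rightarrow> complex ser) \<Rightarrow> bool"
  assumes J: "finite J" and Q0: "Q (\<lambda>_. 0)"
    and lim: "\<And>K u l. 1 \<le> K \<Longrightarrow> (\<And>p a. u p a \<in> sball m K) \<Longrightarrow>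
      (\<And>a \<eta> i. (\<lambda>p. u p a \<eta> i) \<longlonglongrightarrow> l a \<eta> i) \<Longrightarrow> Q l \<Longrightarrow> \<exists>p::nat. Q (u p)"
  obtains V where "silva_nbhd0 m V"
    "\<And>u. (\<And>a. a \<in> J \<Longrightarrow> u a \<in> V) \<Longrightarrow> (\<And>a. a \<notin> J \<Longrightarrow> u a = 0) \<Longrightarrow> Q u"
proof -
  \<comment> \<open>Admissible weights: the box lies in a norm ball, which provides the compactness,
    and \<open>Q\<close> holds for all families with values in it.\<close>
  define G where "G v \<longleftrightarrow> (\<forall>n. 0 \<le> v n) \<and> (\<exists>K\<ge>1. \<forall>n. v n \<le> K ^ Suc n * fact n) \<and>
     (\<forall>u. (\<forall>a. u a \<in> ser_box m v) \<longrightarrow> Q u)" for v :: "nat \<Rightarrow> real"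
  have base: "G (\<lambda>_. 0)"
    unfolding G_def
  proof (intro conjI allI impI)
    show "\<exists>K\<ge>1. \<forall>n. 0 \<le> K ^ Suc n * (fact n :: real)" by (intro exI[of _ 1]) auto
    fix u :: "'a \<Rightarrow> complex ser" assume "\<forall>a. u a \<in> ser_box m (\<lambda>_. 0)"
    then have "u = (\<lambda>_. 0)" by (auto simp: ser_box_def fun_eq_iff)
    then show "Q u" using Q0 by simp
  qed simp
  have step: "\<exists>w. G w \<and> (\<forall>n. v n \<le> w n) \<and> (\<exists>e>0. \<forall>n. e * real (Suc j) ^ n * fact n \<le> w n)"
    if v: "G v" for v j
  proof -
    \<comment> \<open>The box is enlarged by the ball of radius 1 / (p + 1) in the step of weight
      \<open>Suc j\<close>; the aim is that some \<open>p\<close> keeps it admissible.\<close>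
    define w where "w p n = max (v n) (1 / real (Suc p) * real (Suc j) ^ n * fact n)" for p n
    obtain K0 where K0: "1 \<le> K0" "\<And>n. v n \<le> K0 ^ Suc n * fact n" using v G_def by blast
    define K where "K = max K0 (real (Suc j))"
    have K: "1 \<le> K" using K0 by (simp add: K_def)
    have wK: "w p n \<le> K ^ Suc n * fact n" for p n
    proof -
      have "K0 ^ Suc n * fact n \<le> K ^ Suc n * fact n"
        using K0 by (intro mult_right_mono power_mono) (auto simp: K_def)
      moreover have "1 / real (Suc p) \<le> K" using K by (simp add: divide_le_eq) (smt (verit) mult_le_cancel_right1 of_nat_0_le_iff)
      then have "1 / real (Suc p) * real (Suc j) ^ n \<le> K * K ^ n"
        using K by (intro mult_mono power_mono) (auto simp: K_def)
      then have "1 / real (Suc p) * real (Suc j) ^ n * fact n \<le> K ^ Suc n * fact n"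
        by (intro mult_right_mono) auto
      ultimately show ?thesis
        unfolding w_def using order_trans[OF K0(2)[of n]] by (intro max.boundedI) blast+
    qed
    have "\<exists>p. \<forall>u. (\<forall>a. u a \<in> ser_box m (w p)) \<longrightarrow> Q u"
    proof (rule ccontr)
      \<comment> \<open>Every \<open>p\<close> then has a counterexample. Since the radii tend to 0,
        a coefficientwise limit of these lies in the old box, where \<open>Q\<close> holds; by
        \<open>lim\<close> it also holds at one of the counterexamples.\<close>
      assume "\<not> ?thesis"
      then obtain u where u: "\<And>p a. u p a \<in> ser_box m (w p)" "\<And>p. \<not> Q (u p)" by metis
      have uK: "u p a \<in> sball m K" for p a using u(1) ser_box_sball[of "w p" K m] wK by blast
      have uB: "norm (u p a \<eta> i) \<le> (\<lambda>\<eta>. K ^ Suc (length \<eta>) * fact (length \<eta>)) \<eta>" for p a \<eta> i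
        using uK by (simp add: sball_def)
      obtain r l where r: "strict_mono r"
        and l: "\<And>a \<eta> i. (\<lambda>p. u (r p) a \<eta> i) \<longlonglongrightarrow> l a \<eta> i"
        by (rule pointwise_bounded_convergent_subseq_ser[of u, OF uB]) blast
      have "l a \<in> ser_box m v" for a
        unfolding ser_box_def wf_ser_def
      proof (intro CollectI conjI allI impI)
        fix \<eta> :: "nat list" and i
        have "(\<lambda>p. 1 / real (Suc p)) \<longlonglongrightarrow> 0" by (rule LIMSEQ_Suc[OF lim_1_over_n])
        then have "(\<lambda>p. 1 / real (Suc (r p))) \<longlonglongrightarrow> 0"
          using LIMSEQ_subseq_LIMSEQ[OF _ r] unfolding o_def by blast
        then have "(\<lambda>p. w (r p) (length \<eta>)) \<longlonglongrightarrow>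
            max (v (length \<eta>)) (0 * real (Suc j) ^ length \<eta> * fact (length \<eta>))"
          unfolding w_def by (intro tendsto_intros)
        moreover have "max (v (length \<eta>)) 0 = v (length \<eta>)" using v by (simp add: G_def)
        ultimately have "(\<lambda>p. w (r p) (length \<eta>)) \<longlonglongrightarrow> v (length \<eta>)" by simp
        then show "norm (l a \<eta> i) \<le> v (length \<eta>)"
          by (rule LIMSEQ_le[OF tendsto_norm[OF l[of a \<eta> i]]]) (use u in \<open>auto simp: ser_box_def\<close>)
      next
        fix \<eta> i assume "\<not> set \<eta> \<subseteq> {0..m} \<or> i \<notin> {1..m}"
        then have "u (r p) a \<eta> i = 0" for p using u unfolding ser_box_def wf_ser_def by blast
        then show "l a \<eta> i = 0" using l[of a \<eta> i] by (simp add: LIMSEQ_const_iff)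
      qed
      then have "Q l" using v unfolding G_def by blast
      then obtain p where "Q (u (r p))"
        using lim[of K "\<lambda>p. u (r p)" l, OF K uK l] by blast
      then show False using u(2) by blast
    qed
    then obtain p where p: "\<And>u. (\<And>a. u a \<in> ser_box m (w p)) \<Longrightarrow> Q u" by blast
    have "G (w p)"
      unfolding G_def using p K wK v by (auto simp: G_def w_def le_max_iff_disj)
    moreover have "v n \<le> w p n" "1 / real (Suc p) * real (Suc j) ^ n * fact n \<le> w p n" for n
      by (simp_all add: w_def)
    moreover have "1 / real (Suc p) > 0" by simp
    ultimately show ?thesis by blast
  qed
  have "\<exists>v. \<forall>j. G (v j) \<and> ((\<forall>n. v j n \<le> v (Suc j) n) \<and>
      (\<exists>e>0. \<forall>n. e * real (Suc j) ^ n * fact n \<le> v (Suc j) n))"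
    by (rule dependent_nat_choice) (use base step in blast)+
  then obtain v where v: "\<And>j. G (v j)" "\<And>j n. v j n \<le> v (Suc j) n"
     "\<And>j. \<exists>e>0. \<forall>n. e * real (Suc j) ^ n * fact n \<le> v (Suc j) n"
    by blast
  show ?thesis
  proof (rule that[of "\<Union>j. ser_box m (v j)"])
    show "silva_nbhd0 m (\<Union>j. ser_box m (v j) :: complex ser set)"
      by (rule silva_nbhd0_Union_ser_box) (use v G_def in auto)
    fix u :: "'a \<Rightarrow> complex ser"
    assume u: "\<And>a. a \<in> J \<Longrightarrow> u a \<in> (\<Union>j. ser_box m (v j))" "\<And>a. a \<notin> J \<Longrightarrow> u a = 0"
    then have "\<forall>a\<in>J. \<exists>j. u a \<in> ser_box m (v j)" by blast
    from bchoice[OF this] obtain f where f: "\<And>a. a \<in> J \<Longrightarrow> u a \<in> ser_box m (v (f a))" by blast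
    \<comment> \<open>Finitely many values share a box of the increasing sequence, and the zeros off
      \<open>J\<close> lie in every box.\<close>
    obtain N where N: "\<And>a. a \<in> J \<Longrightarrow> f a \<le> N"
      using finite_nat_set_iff_bounded_le[of "f ` J"] J by auto
    have "u a \<in> ser_box m (v N)" for a
    proof (cases "a \<in> J")
      case True
      have "v (f a) n \<le> v N n" for n
        by (rule lift_Suc_mono_le[of "\<lambda>j. v j n", OF v(2) N[OF True]])
      then show ?thesis using f[OF True] ser_box_mono[of "v (f a)" "v N" m] by blast
    next
      case False
      then show ?thesis using u(2) v(1)[of N] by (simp add: ser_box_def wf_ser_def G_def)
    qed
    then show "Q u" using v(1) G_def by blast
  qed
qed

section \<open>Polynomial functions of finitely many coefficients\<close>

inductive polyfun :: "'a set \<Rightarrow> (('a \<Rightarrow> 'k::comm_ring_1 ser) \<Rightarrow> 'k) \<Rightarrow> bool" for J where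
  polyfun_const: "polyfun J (\<lambda>_. s)"
| polyfun_coefficient: "a \<in> J \<Longrightarrow> polyfun J (\<lambda>z. z a \<eta> i)"
| polyfun_add: "polyfun J p \<Longrightarrow> polyfun J q \<Longrightarrow> polyfun J (\<lambda>z. p z + q z)"
| polyfun_mult: "polyfun J p \<Longrightarrow> polyfun J q \<Longrightarrow> polyfun J (\<lambda>z. p z * q z)"

lemma polyfun_uminus: "polyfun J p \<Longrightarrow> polyfun J (\<lambda>z. - p z)"
  using polyfun_mult[OF polyfun_const[of J "-1"], of p] by simp

lemma polyfun_sum: "(\<And>x. x \<in> A \<Longrightarrow> polyfun J (p x)) \<Longrightarrow> polyfun J (\<lambda>z. \<Sum>x\<in>A. p x z)"
  by (induction A rule: infinite_finite_induct) (auto intro: polyfun_const polyfun_add)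

lemma polyfun_cong: "polyfun J p \<Longrightarrow> (\<And>a. a \<in> J \<Longrightarrow> z a = z' a) \<Longrightarrow> p z = p z'"
  by (induction rule: polyfun.induct) auto

lemma tendsto_polyfun:
  fixes p :: "('a \<Rightarrow> complex ser) \<Rightarrow> complex"
  assumes "polyfun J p" "\<And>a \<eta> i. a \<in> J \<Longrightarrow> ((\<lambda>x. z x a \<eta> i) \<longlongrightarrow> l a \<eta> i) F"
  shows "((\<lambda>x. p (z x)) \<longlongrightarrow> p l) F"
  using assms by (induction rule: polyfun.induct) (auto intro: tendsto_intros)

text \<open>The direction in which variable \<open>a\<close> moves is itself the variable
  \<open>\<sigma> a\<close>. So a directional derivative is again a function of a family, only with
  more variables, and differentiation can be iterated.\<close>

definition perturb :: "'a set \<Rightarrow> ('a \<Rightarrow> 'a) \<Rightarrow> 'k::comm_ring_1 \<Rightarrow> ('a \<Rightarrow> 'k ser) \<Rightarrow> 'a \<Rightarrow> 'k ser" where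
  "perturb A \<sigma> t z a = (if a \<in> A then z a + ser_scale t (z (\<sigma> a)) else z a)"

lemma perturb_0 [simp]: "perturb A \<sigma> 0 z = z"
  by (auto simp: perturb_def ser_scale_def fun_eq_iff)

lemma perturb_coefficient:
  "perturb A \<sigma> t z a \<eta> i = z a \<eta> i + t * (if a \<in> A then z (\<sigma> a) \<eta> i else 0)"
  by (simp add: perturb_def ser_scale_def)

lemma polyfun_holomorphic:
  "polyfun J p \<Longrightarrow> (\<lambda>t. p (perturb A \<sigma> t z)) holomorphic_on S"
  by (induction rule: polyfun.induct) (auto simp: perturb_coefficient intro!: holomorphic_intros)

lemma polyfun_deriv:
  fixes p :: "('a \<Rightarrow> complex ser) \<Rightarrow> complex"
  assumes "polyfun J p" "J \<subseteq> J'" "\<sigma> ` A \<subseteq> J'"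
  shows "\<exists>q. polyfun J' q \<and> (\<forall>z. ((\<lambda>t. p (perturb A \<sigma> t z)) has_field_derivative q z) (at 0))"
  using assms(1)
proof induction
  case (polyfun_const s)
  then show ?case by (intro exI[of _ "\<lambda>_. 0"]) (auto intro: polyfun.polyfun_const)
next
  case (polyfun_coefficient a \<eta> i)
  show ?case
  proof (intro exI[of _ "\<lambda>z. if a \<in> A then z (\<sigma> a) \<eta> i else 0"] conjI allI)
    show "polyfun J' (\<lambda>z. if a \<in> A then z (\<sigma> a) \<eta> i else 0)"
      using assms by (cases "a \<in> A") (auto intro: polyfun.intros)
    fix z :: "'a \<Rightarrow> complex ser"
    show "((\<lambda>t. perturb A \<sigma> t z a \<eta> i) has_field_derivative (if a \<in> A then z (\<sigma> a) \<eta> i else 0)) (at 0)"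
      unfolding perturb_coefficient by (auto intro!: derivative_eq_intros)
  qed
next
  case (polyfun_add p q)
  then obtain p' q' where "polyfun J' p'" "polyfun J' q'"
    "\<And>z. ((\<lambda>t. p (perturb A \<sigma> t z)) has_field_derivative p' z) (at 0)"
    "\<And>z. ((\<lambda>t. q (perturb A \<sigma> t z)) has_field_derivative q' z) (at 0)" by blast
  then show ?case
    by (intro exI[of _ "\<lambda>z. p' z + q' z"]) (auto intro: polyfun.polyfun_add DERIV_add)
next
  case (polyfun_mult p q)
  then obtain p' q' where *: "polyfun J' p'" "polyfun J' q'"
    "\<And>z. ((\<lambda>t. p (perturb A \<sigma> t z)) has_field_derivative p' z) (at 0)"
    "\<And>z. ((\<lambda>t. q (perturb A \<sigma> t z)) has_field_derivative q' z) (at 0)" by blast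
  \<comment> \<open>The product rule brings back the undifferentiated factors, which must be read
    over the larger set of variables.\<close>
  have mono: "polyfun J r \<Longrightarrow> polyfun J' r" for r :: "('a \<Rightarrow> complex ser) \<Rightarrow> complex"
    by (induction rule: polyfun.induct) (use assms in \<open>auto intro: polyfun.intros\<close>)
  show ?case
  proof (intro exI[of _ "\<lambda>z. p' z * q z + q' z * p z"] conjI allI)
    show "polyfun J' (\<lambda>z. p' z * q z + q' z * p z)"
      using * mono polyfun_mult by (intro polyfun.polyfun_add polyfun.polyfun_mult) auto
    fix z show "((\<lambda>t. p (perturb A \<sigma> t z) * q (perturb A \<sigma> t z)) has_field_derivative
       p' z * q z + q' z * p z) (at 0)"
      using DERIV_mult[OF *(3,4)[of z]] by simp
  qed
qed

text \<open>Cauchy's estimate on discs of radius 1/2 about points of the half disc bounds the second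
  derivative by 2 C / (1/2)^2 = 8 C, and Taylor's formula does the rest. The constants depend on
  \<open>f\<close> only through \<open>C\<close>, which makes the rate uniform over all
  coefficients.\<close>

lemma Cauchy_first_order:
  fixes f :: "complex \<Rightarrow> complex"
  assumes hol: "f holomorphic_on UNIV" and C: "\<And>t. norm t \<le> 1 \<Longrightarrow> norm (f t) \<le> C"
    and D: "(f has_field_derivative D) (at 0)"
  shows "norm D \<le> C"
    and "norm t \<le> 1/2 \<Longrightarrow> t \<noteq> 0 \<Longrightarrow> norm ((f t - f 0) / t - D) \<le> 8 * C * norm t"
proof -
  have cont: "continuous_on S f" for S
    using hol holomorphic_on_imp_continuous_on holomorphic_on_subset by blast
  have hol': "f holomorphic_on S" for S using hol holomorphic_on_subset by blast
  have D': "deriv f 0 = D" using D by (rule DERIV_imp_deriv)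
  have "norm ((deriv ^^ 1) f 0) \<le> fact 1 * C / 1 ^ 1"
    by (rule Cauchy_inequality) (auto simp: C intro: cont hol')
  then show "norm D \<le> C" using D' by simp
  assume t: "norm t \<le> 1/2" "t \<noteq> 0"
  have der: "((deriv ^^ i) f has_field_derivative (deriv ^^ Suc i) f x) (at x within S)" for i x S
    using has_field_derivative_higher_deriv[OF hol, of x i] has_field_derivative_at_within by blast
  have B: "norm ((deriv ^^ 2) f x) \<le> 8 * C" if "x \<in> cball 0 (1/2)" for x
  proof -
    have "norm ((deriv ^^ 2) f x) \<le> fact 2 * C / (1/2) ^ 2"
    proof (rule Cauchy_inequality)
      fix y assume y: "norm (x - y) = 1/2"
      have "norm y \<le> norm x + norm (x - y)" by (metis norm_minus_commute norm_triangle_sub)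
      then show "norm (f y) \<le> C" using that y by (intro C) auto
    qed (auto intro: cont hol')
    then show ?thesis by (simp add: power2_eq_square)
  qed
  have "norm ((deriv ^^ 0) f t - (\<Sum>i\<le>1. (deriv ^^ i) f 0 * (t - 0) ^ i / fact i))
      \<le> 8 * C * norm (t - 0) ^ Suc 1 / fact 1"
    by (rule complex_Taylor[of "cball 0 (1/2)"]) (use der B t in \<open>auto simp: numeral_2_eq_2\<close>)
  then have *: "norm (f t - f 0 - D * t) \<le> 8 * C * norm t ^ 2"
    using D' by (simp add: power2_eq_square algebra_simps)
  have "(f t - f 0) / t - D = (f t - f 0 - D * t) / t" using t by (simp add: field_simps)
  then have "norm ((f t - f 0) / t - D) = norm (f t - f 0 - D * t) / norm t"
    by (simp add: norm_divide)
  also have "\<dots> \<le> 8 * C * norm t ^ 2 / norm t"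
    using * by (intro divide_right_mono) auto
  finally show "norm ((f t - f 0) / t - D) \<le> 8 * C * norm t"
    using t by (simp add: power2_eq_square)
qed

section \<open>Maps with polynomial coefficients that are bounded on balls\<close>

definition hol :: "nat \<Rightarrow> 'a set \<Rightarrow> (('a \<Rightarrow> complex ser) \<Rightarrow> complex ser) \<Rightarrow> bool" where
  "hol m J F \<longleftrightarrow> (\<forall>\<eta> i. polyfun J (\<lambda>z. F z \<eta> i)) \<and>
     (\<forall>K\<ge>1. \<exists>K'\<ge>1. \<forall>z. (\<forall>a\<in>J. z a \<in> sball m K) \<longrightarrow> F z \<in> sball m K')"

lemma hol_polyfun: "hol m J F \<Longrightarrow> polyfun J (\<lambda>z. F z \<eta> i)"
  by (simp add: hol_def)

lemma hol_sball:
  assumes "hol m J F" "1 \<le> K"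
  obtains K' where "1 \<le> K'" "\<And>z. (\<And>a. a \<in> J \<Longrightarrow> z a \<in> sball m K) \<Longrightarrow> F z \<in> sball m K'"
  using assms unfolding hol_def by blast

lemma hol_cong:
  assumes "hol m J F" "\<And>a. a \<in> J \<Longrightarrow> z a = z' a"
  shows "F z = F z'"
  using polyfun_cong[OF hol_polyfun[OF assms(1)], of z z'] assms(2) by (simp add: fun_eq_iff)

lemma LC_common_sball:
  assumes "finite J" "\<And>a. a \<in> J \<Longrightarrow> z a \<in> LC m"
  obtains K where "1 \<le> K" "\<And>a. a \<in> J \<Longrightarrow> z a \<in> sball m K"
proof -
  have "\<exists>K\<ge>1. \<forall>a\<in>J. z a \<in> sball m K"
    using assms
  proof (induction J)
    case (insert b J)
    then obtain K where K: "1 \<le> K" "\<And>a. a \<in> J \<Longrightarrow> z a \<in> sball m K" by auto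
    obtain L where L: "1 \<le> L" "z b \<in> sball m L" using insert.prems LC_iff by blast
    have "sball m K \<subseteq> sball m (max K L)" "sball m L \<subseteq> sball m (max K L)"
      by (rule sball_mono; use K L in simp)+
    then show ?case using K L by (intro exI[of _ "max K L"]) auto
  qed auto
  then show ?thesis using that by blast
qed

lemma hol_LC:
  assumes "hol m J F" "finite J" "\<And>a. a \<in> J \<Longrightarrow> z a \<in> LC m"
  shows "F z \<in> LC m"
proof -
  obtain K where K: "1 \<le> K" "\<And>a. a \<in> J \<Longrightarrow> z a \<in> sball m K"
    by (rule LC_common_sball[where J = J and z = z and m = m]) (use assms in blast)+
  obtain K' where "1 \<le> K'" "\<And>z. (\<And>a. a \<in> J \<Longrightarrow> z a \<in> sball m K) \<Longrightarrow> F z \<in> sball m K'"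
    by (rule hol_sball[OF assms(1) K(1)]) blast
  then show ?thesis using K unfolding LC_iff by blast
qed

text \<open>\<open>silva_nbhd0_of_ball_condition\<close> is applied to the property that the
  translate of \<open>u\<close> by \<open>z\<close> is mapped into \<open>U\<close>. For a
  coefficientwise convergent sequence in one ball, the values stay in one ball and converge
  coefficientwise, hence also in the Silva topology.\<close>

lemma hol_continuous:
  fixes F :: "('a::countable \<Rightarrow> complex ser) \<Rightarrow> complex ser"
  assumes F: "hol m J F" and J: "finite J" and z: "\<And>a. a \<in> J \<Longrightarrow> z a \<in> LC m"
    and U: "openin (silva_top m) U" "F z \<in> U"
  obtains V where "silva_nbhd0 m V" "\<And>y. (\<And>a. a \<in> J \<Longrightarrow> y a - z a \<in> V) \<Longrightarrow> F y \<in> U"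
proof -
  define T where "T u = (\<lambda>a. if a \<in> J then z a + u a else 0)" for u :: "'a \<Rightarrow> complex ser"
  obtain Kz where Kz: "1 \<le> Kz" "\<And>a. a \<in> J \<Longrightarrow> z a \<in> sball m Kz"
    by (rule LC_common_sball[where J = J and z = z and m = m]) (use J z in blast)+
  have Q0: "F (T (\<lambda>_. 0)) \<in> U"
    using U(2) hol_cong[OF F, of "T (\<lambda>_. 0)" z] by (simp add: T_def)
  have lim: "\<exists>p::nat. F (T (u p)) \<in> U"
    if K: "1 \<le> K" and u: "\<And>p a. u p a \<in> sball m K"
      and l: "\<And>a \<eta> i. (\<lambda>p. u p a \<eta> i) \<longlonglongrightarrow> l a \<eta> i" and Fl: "F (T l) \<in> U" for K u l
  proof -
    obtain W where W: "silva_nbhd0 m W" "\<And>y. y - F (T l) \<in> W \<Longrightarrow> y \<in> U"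
      by (rule openin_silva_nbhd[OF U(1) Fl]) blast
    have "F (T l) \<in> LC m" using Fl openin_subset[OF U(1)] by auto
    then obtain K1 where K1: "1 \<le> K1" "F (T l) \<in> sball m K1" unfolding LC_iff by blast
    have "1 \<le> Kz + K" using K Kz by simp
    then obtain K2 where K2: "1 \<le> K2"
      "\<And>y. (\<And>a. a \<in> J \<Longrightarrow> y a \<in> sball m (Kz + K)) \<Longrightarrow> F y \<in> sball m K2"
      by (rule hol_sball[OF F]) blast
    have inK2: "F (T (u p)) \<in> sball m K2" for p
      by (rule K2(2)) (use Kz K u in \<open>auto simp: T_def intro!: sball_add\<close>)
    have "ser_scale (-1) (F (T l)) \<in> sball m K1" by (rule sball_scale[OF K1(2)]) simp
    then have "F (T (u p)) + ser_scale (-1) (F (T l)) \<in> sball m (K2 + K1)" for p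
      using inK2 K1 K2 by (intro sball_add) auto
    moreover have "F (T (u p)) + ser_scale (-1) (F (T l)) = F (T (u p)) - F (T l)" for p
      by (auto simp: ser_scale_def fun_eq_iff)
    ultimately have ball: "F (T (u p)) - F (T l) \<in> sball m (K2 + K1)" for p by metis
    have "(\<lambda>p. F (T (u p)) \<eta> i) \<longlonglongrightarrow> F (T l) \<eta> i" for \<eta> i
      by (rule tendsto_polyfun[OF hol_polyfun[OF F]])
         (use l in \<open>auto simp: T_def intro!: tendsto_intros\<close>)
    then have "(\<lambda>p. (F (T (u p)) - F (T l)) \<eta> i) \<longlonglongrightarrow> 0" for \<eta> i
      by (simp add: LIM_zero)
    then have "\<forall>\<^sub>F p in sequentially. F (T (u p)) - F (T l) \<in> W"
      using K1 K2 ball by (intro eventually_in_nbhd0[OF W(1), of "K2 + K1"]) auto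
    then obtain p where "F (T (u p)) - F (T l) \<in> W"
      using eventually_happens trivial_limit_sequentially by blast
    then show ?thesis using W(2) by blast
  qed
  show ?thesis
  proof (rule silva_nbhd0_of_ball_condition[OF J, of "\<lambda>u. F (T u) \<in> U" m, OF Q0 lim])
    fix V assume V: "silva_nbhd0 m V"
      "\<And>u. (\<And>a. a \<in> J \<Longrightarrow> u a \<in> V) \<Longrightarrow> (\<And>a. a \<notin> J \<Longrightarrow> u a = 0) \<Longrightarrow> F (T u) \<in> U"
    show ?thesis
    proof (rule that[OF V(1)])
      fix y assume y: "\<And>a. a \<in> J \<Longrightarrow> y a - z a \<in> V"
      let ?u = "\<lambda>a. if a \<in> J then y a - z a else 0"
      have "F (T ?u) \<in> U" by (rule V(2)) (use y in auto)
      moreover have "F (T ?u) = F y" by (rule hol_cong[OF F]) (simp add: T_def)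
      ultimately show "F y \<in> U" by simp
    qed
  qed
qed

text \<open>If the family lies in the ball \<open>K\<close>, its perturbations with |t| \<le> 1 lie
  in the ball 2 K, so one \<open>K'\<close> bounds \<open>F\<close> along the unit disc. Cauchy's
  estimate puts the derivative in the ball \<open>K'\<close> and makes the difference quotients
  converge at rate 8 K' |t| in the norm of a single step.\<close>

lemma hol_deriv:
  fixes F :: "('a \<Rightarrow> complex ser) \<Rightarrow> complex ser"
  assumes F: "hol m J F" and sub: "J \<subseteq> J'" "\<sigma> ` A \<subseteq> J'" and J': "finite J'"
  obtains G where "hol m J' G"
    "\<And>z. (\<And>a. a \<in> J' \<Longrightarrow> z a \<in> LC m) \<Longrightarrow>
       limitin (silva_top m) (\<lambda>t. ser_scale (inverse t) (F (perturb A \<sigma> t z) - F z)) (G z) (at 0)"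
proof -
  have "\<forall>x. \<exists>q. polyfun J' q \<and>
     (\<forall>z. ((\<lambda>t. F (perturb A \<sigma> t z) (fst x) (snd x)) has_field_derivative q z) (at 0))"
    using polyfun_deriv[OF hol_polyfun[OF F] sub] by blast
  from choice[OF this] obtain q where q: "\<And>x. polyfun J' (q x)"
    "\<And>x z. ((\<lambda>t. F (perturb A \<sigma> t z) (fst x) (snd x)) has_field_derivative q x z) (at 0)"
    by blast
  define G where "G z \<eta> i = q (\<eta>, i) z" for z \<eta> i
  have der: "((\<lambda>t. F (perturb A \<sigma> t z) \<eta> i) has_field_derivative G z \<eta> i) (at 0)" for z \<eta> i
    using q(2)[of z "(\<eta>, i)"] by (simp add: G_def)
  have hol': "(\<lambda>t. F (perturb A \<sigma> t z) \<eta> i) holomorphic_on UNIV" for z \<eta> i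
    by (rule polyfun_holomorphic[OF hol_polyfun[OF F]])
  have bound: "\<exists>K'\<ge>1. \<forall>z. (\<forall>a\<in>J'. z a \<in> sball m K) \<longrightarrow> G z \<in> sball m K' \<and>
      (\<forall>t. t \<noteq> 0 \<longrightarrow> norm t \<le> 1/2 \<longrightarrow>
        wf_ser m (ser_scale (inverse t) (F (perturb A \<sigma> t z) - F z) - G z) \<and>
        (\<forall>\<eta> i. norm ((ser_scale (inverse t) (F (perturb A \<sigma> t z) - F z) - G z) \<eta> i)
           \<le> 8 * K' * norm t * K' ^ length \<eta> * fact (length \<eta>)))"
    if K: "1 \<le> K" for K
  proof -
    have "1 \<le> K + K" using K by simp
    then obtain K' where K': "1 \<le> K'"
      "\<And>z. (\<And>a. a \<in> J \<Longrightarrow> z a \<in> sball m (K + K)) \<Longrightarrow> F z \<in> sball m K'"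
      by (rule hol_sball[OF F]) blast
    show ?thesis
    proof (intro exI[of _ K'] conjI[OF K'(1)] allI impI)
      fix z :: "'a \<Rightarrow> complex ser" assume z: "\<forall>a\<in>J'. z a \<in> sball m K"
      have ball: "F (perturb A \<sigma> t z) \<in> sball m K'" if "norm t \<le> 1" for t
      proof (rule K'(2))
        fix a assume a: "a \<in> J"
        have "(sball m K :: complex ser set) \<subseteq> sball m (K + K)" by (rule sball_mono) (use K in auto)
        moreover have "z a + ser_scale t (z (\<sigma> a)) \<in> sball m (K + K)" if "a \<in> A"
          by (intro sball_add sball_scale) (use z a sub that K \<open>norm t \<le> 1\<close> in auto)
        ultimately show "perturb A \<sigma> t z a \<in> sball m (K + K)"
          using z a sub unfolding perturb_def by auto
      qed
      \<comment> \<open>This bound is 0 off the support, so the estimate for the derivative also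
        yields \<open>wf_ser\<close>.\<close>
      define C where "C \<eta> i = (if set \<eta> \<subseteq> {0..m} \<and> i \<in> {1..m} then K' ^ Suc (length \<eta>) * fact (length \<eta>) else 0)"
        for \<eta> i
      have C: "norm (F (perturb A \<sigma> t z) \<eta> i) \<le> C \<eta> i" if "norm t \<le> 1" for t \<eta> i
        using ball[OF that] by (simp add: C_def sball_def wf_ser_def)
      have C': "C \<eta> i \<le> K' ^ Suc (length \<eta>) * fact (length \<eta>)" for \<eta> i
        using K' by (simp add: C_def)
      have G: "norm (G z \<eta> i) \<le> C \<eta> i" for \<eta> i
        by (rule Cauchy_first_order(1)[OF hol' C der])
      have "wf_ser m (G z)"
        unfolding wf_ser_def
      proof (intro allI impI)
        fix \<eta> i assume "\<not> set \<eta> \<subseteq> {0..m} \<or> i \<notin> {1..m}"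
        then have "C \<eta> i = 0" unfolding C_def by meson
        then show "G z \<eta> i = 0" using G[of \<eta> i] by simp
      qed
      moreover have "norm (G z \<eta> i) \<le> K' ^ Suc (length \<eta>) * fact (length \<eta>)" for \<eta> i
        using G C' order_trans by blast
      ultimately have Gball: "G z \<in> sball m K'" by (simp add: sball_def)
      show "G z \<in> sball m K' \<and> (\<forall>t. t \<noteq> 0 \<longrightarrow> norm t \<le> 1/2 \<longrightarrow>
        wf_ser m (ser_scale (inverse t) (F (perturb A \<sigma> t z) - F z) - G z) \<and>
        (\<forall>\<eta> i. norm ((ser_scale (inverse t) (F (perturb A \<sigma> t z) - F z) - G z) \<eta> i)
           \<le> 8 * K' * norm t * K' ^ length \<eta> * fact (length \<eta>)))"
      proof (intro conjI[OF Gball] allI impI)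
        fix t :: complex assume t: "t \<noteq> 0" "norm t \<le> 1/2"
        have "wf_ser m (F (perturb A \<sigma> t z))" "wf_ser m (F (perturb A \<sigma> 0 z))" "wf_ser m (G z)"
          using ball[of t] ball[of 0] t Gball by (auto simp: sball_def)
        then have wf: "wf_ser m (ser_scale (inverse t) (F (perturb A \<sigma> t z) - F z) - G z)"
          by (auto simp: wf_ser_def ser_scale_def)
        have "norm ((ser_scale (inverse t) (F (perturb A \<sigma> t z) - F z) - G z) \<eta> i)
           \<le> 8 * K' * norm t * K' ^ length \<eta> * fact (length \<eta>)" for \<eta> i
        proof -
          have "norm ((F (perturb A \<sigma> t z) \<eta> i - F (perturb A \<sigma> 0 z) \<eta> i) / t - G z \<eta> i) \<le> 8 * C \<eta> i * norm t"
            by (rule Cauchy_first_order(2)[OF hol' C der t(2,1)])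
          also have "\<dots> \<le> 8 * (K' ^ Suc (length \<eta>) * fact (length \<eta>)) * norm t"
            using C' by (intro mult_right_mono mult_left_mono) auto
          finally show ?thesis by (simp add: ser_scale_def divide_inverse mult_ac)
        qed
        with wf show "wf_ser m (ser_scale (inverse t) (F (perturb A \<sigma> t z) - F z) - G z) \<and>
          (\<forall>\<eta> i. norm ((ser_scale (inverse t) (F (perturb A \<sigma> t z) - F z) - G z) \<eta> i)
           \<le> 8 * K' * norm t * K' ^ length \<eta> * fact (length \<eta>))" by blast
      qed
    qed
  qed
  show ?thesis
  proof (rule that)
    show holG: "hol m J' G"
      unfolding hol_def
    proof (intro conjI allI impI)
      show "polyfun J' (\<lambda>z. G z \<eta> i)" for \<eta> i unfolding G_def by (rule q)
      fix K :: real assume "1 \<le> K"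
      from bound[OF this] show "\<exists>K'\<ge>1. \<forall>z. (\<forall>a\<in>J'. z a \<in> sball m K) \<longrightarrow> G z \<in> sball m K'"
        by blast
    qed
    fix z :: "'a \<Rightarrow> complex ser" assume z: "\<And>a. a \<in> J' \<Longrightarrow> z a \<in> LC m"
    obtain K where K: "1 \<le> K" "\<And>a. a \<in> J' \<Longrightarrow> z a \<in> sball m K"
      by (rule LC_common_sball[where J = J' and z = z and m = m]) (use J' z in blast)+
    then obtain K' where K': "1 \<le> K'" "\<And>t. t \<noteq> 0 \<Longrightarrow> norm t \<le> 1/2 \<Longrightarrow>
        wf_ser m (ser_scale (inverse t) (F (perturb A \<sigma> t z) - F z) - G z) \<and>
        (\<forall>\<eta> i. norm ((ser_scale (inverse t) (F (perturb A \<sigma> t z) - F z) - G z) \<eta> i)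
           \<le> 8 * K' * norm t * K' ^ length \<eta> * fact (length \<eta>))"
      using bound[OF K(1)] by metis
    show "limitin (silva_top m) (\<lambda>t. ser_scale (inverse t) (F (perturb A \<sigma> t z) - F z)) (G z) (at 0)"
    proof (rule limitin_silvaI)
      show "G z \<in> LC m" by (rule hol_LC[OF holG J' z])
      fix V :: "complex ser set" assume "silva_nbhd0 m V"
      moreover have "K' > 0" using K' by simp
      ultimately obtain e where e: "e > 0" "\<And>c. wf_ser m c \<Longrightarrow>
          (\<And>\<eta> i. norm (c \<eta> i) \<le> e * K' ^ length \<eta> * fact (length \<eta>)) \<Longrightarrow> c \<in> V"
        unfolding silva_nbhd0_def by metis
      show "\<forall>\<^sub>F t in at 0. ser_scale (inverse t) (F (perturb A \<sigma> t z) - F z) - G z \<in> V"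
        unfolding eventually_at
      \<comment> \<open>The first entry keeps \<open>t\<close> in the half disc where the rate is
        valid, the second ensures 8 K' |t| \<le> e.\<close>
      proof (intro exI[of _ "min (1/2) (e / (8 * K'))"] conjI ballI impI)
        show "0 < min (1/2) (e / (8 * K'))" using e K' by simp
        fix t :: complex assume t: "t \<noteq> 0 \<and> dist t 0 < min (1/2) (e / (8 * K'))"
        then have t': "8 * K' * norm t \<le> e" using K' by (simp add: field_simps)
        note w = K'(2)[of t]
        show "ser_scale (inverse t) (F (perturb A \<sigma> t z) - F z) - G z \<in> V"
        proof (rule e(2))
          show "wf_ser m (ser_scale (inverse t) (F (perturb A \<sigma> t z) - F z) - G z)"
            using w t by auto
          fix \<eta> :: "nat list" and i
          have "8 * K' * norm t * K' ^ length \<eta> * fact (length \<eta>) \<le> e * K' ^ length \<eta> * fact (length \<eta>)"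
            using t' K' by (intro mult_right_mono) auto
          moreover have "norm ((ser_scale (inverse t) (F (perturb A \<sigma> t z) - F z) - G z) \<eta> i)
             \<le> 8 * K' * norm t * K' ^ length \<eta> * fact (length \<eta>)"
            using w t by auto
          ultimately show "norm ((ser_scale (inverse t) (F (perturb A \<sigma> t z) - F z) - G z) \<eta> i)
             \<le> e * K' ^ length \<eta> * fact (length \<eta>)" by (rule order_trans[rotated])
        qed
      qed
    qed
  qed
qed

section \<open>Bastiani analyticity\<close>

text \<open>Treats one argument and pairs alike: points of \<open>X\<close> are described by
  \<open>r\<close> series. By induction, each derivative is a \<open>hol\<close> map of base point
  and directions together, so \<open>hol_deriv\<close> gives the limits and
  \<open>hol_continuous\<close> the joint continuity.\<close>

theorem bastiani_smooth_hol:
  fixes X :: "'v::ab_group_add topology" and coord :: "nat \<Rightarrow> 'v \<Rightarrow> complex ser"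
  assumes top: "\<And>x. x \<in> topspace X \<longleftrightarrow> (\<forall>j<r. coord j x \<in> LC m)"
    and lin: "\<And>j x h t. coord j (x + sv t h) = coord j x + ser_scale t (coord j h)"
    and nbhd: "\<And>x V. x \<in> topspace X \<Longrightarrow> silva_nbhd0 m V \<Longrightarrow>
      \<exists>U. openin X U \<and> x \<in> U \<and> (\<forall>y\<in>U. \<forall>j<r. coord j y - coord j x \<in> V)"
    and F: "hol m ({..<r} \<times> {..0::nat}) F"
    and f: "\<And>x. x \<in> topspace X \<Longrightarrow> f x = F (\<lambda>(j, i). coord j x)"
  shows "bastiani_smooth sv ser_scale X (silva_top m) (topspace X) f"
proof -
  let ?T = "topspace X" and ?J = "\<lambda>k::nat. {..<r} \<times> {..k}"
  let ?d = "bderiv sv ser_scale (silva_top m) f"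
  \<comment> \<open>Index (j, 0) holds component j of the base point, and (j, i + 1) that of
    direction \<open>hs i\<close>.\<close>
  define enc where "enc x hs = (\<lambda>(j, i). coord j (case i of 0 \<Rightarrow> x | Suc i' \<Rightarrow> hs i'))"
    for x and hs :: "nat \<Rightarrow> 'v"
  have enc_LC: "enc x hs a \<in> LC m" if "x \<in> ?T" "\<forall>i<k. hs i \<in> ?T" "a \<in> ?J k" for x hs k a
    using that top by (auto simp: enc_def split: nat.splits)
  define D where "D k G \<longleftrightarrow> hol m (?J k) G \<and>
     (\<forall>x\<in>?T. \<forall>hs. (\<forall>i<k. hs i \<in> ?T) \<longrightarrow> ?d k x hs = G (enc x hs))" for k G
  have step: "\<exists>G'. D (Suc k) G' \<and> (\<forall>x\<in>?T. \<forall>hs. (\<forall>i<Suc k. hs i \<in> ?T) \<longrightarrow>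
      limitin (silva_top m) (\<lambda>t. ser_scale (inverse t) (?d k (x + sv t (hs k)) hs - ?d k x hs))
        (G' (enc x hs)) (at 0))" if DG: "D k G" for k G
  proof -
    \<comment> \<open>Only the base point moves, in direction \<open>hs k\<close>, which is stored
      under the second index \<open>Suc k\<close>.\<close>
    let ?A = "{..<r} \<times> {0::nat}" and ?\<sigma> = "\<lambda>(j::nat, i::nat). (j, Suc k)"
    obtain G' where G': "hol m (?J (Suc k)) G'"
      "\<And>z. (\<And>a. a \<in> ?J (Suc k) \<Longrightarrow> z a \<in> LC m) \<Longrightarrow>
         limitin (silva_top m) (\<lambda>t. ser_scale (inverse t) (G (perturb ?A ?\<sigma> t z) - G z)) (G' z) (at 0)"
      by (rule hol_deriv[of m "?J k" G "?J (Suc k)" ?\<sigma> ?A]) (use DG in \<open>auto simp: D_def\<close>)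
    have lim: "limitin (silva_top m) (\<lambda>t. ser_scale (inverse t) (?d k (x + sv t (hs k)) hs - ?d k x hs))
        (G' (enc x hs)) (at 0)" if x: "x \<in> ?T" and hs: "\<forall>i<Suc k. hs i \<in> ?T" for x hs
    proof -
      have hk: "\<forall>i<k. hs i \<in> ?T" using hs by simp
      have xt: "x + sv t (hs k) \<in> ?T" for t
        using x hs unfolding top lin by (auto intro!: LC_add LC_scale)
      have "?d k (x + sv t (hs k)) hs = G (perturb ?A ?\<sigma> t (enc x hs))" for t
      proof -
        have "?d k (x + sv t (hs k)) hs = G (enc (x + sv t (hs k)) hs)"
          using DG xt hk unfolding D_def by blast
        also have "\<dots> = G (perturb ?A ?\<sigma> t (enc x hs))"
          using DG unfolding D_def
          by (intro hol_cong[of m "?J k" G]) (auto simp: enc_def perturb_def lin split: nat.splits)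
        finally show ?thesis .
      qed
      moreover have "?d k x hs = G (enc x hs)" using DG x hk unfolding D_def by blast
      moreover have "limitin (silva_top m)
          (\<lambda>t. ser_scale (inverse t) (G (perturb ?A ?\<sigma> t (enc x hs)) - G (enc x hs))) (G' (enc x hs)) (at 0)"
        by (rule G'(2)) (rule enc_LC[OF x hs])
      ultimately show ?thesis by simp
    qed
    have "?d (Suc k) x hs = G' (enc x hs)" if x: "x \<in> ?T" and hs: "\<forall>i<Suc k. hs i \<in> ?T" for x hs
      unfolding bderiv.simps
      by (intro the_equality lim[OF x hs] limitin_silva_unique[OF _ lim[OF x hs]]) simp_all
    then have "D (Suc k) G'" using G'(1) unfolding D_def by blast
    then show ?thesis using lim by blast
  qed
  have "D 0 F"
    unfolding D_def
  proof (intro conjI ballI allI impI)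
    fix x and hs :: "nat \<Rightarrow> 'v" assume "x \<in> ?T"
    then have "f x = F (\<lambda>(j, i). coord j x)" by (rule f)
    also have "\<dots> = F (enc x hs)" by (rule hol_cong[OF F]) (auto simp: enc_def)
    finally show "?d 0 x hs = F (enc x hs)" by simp
  qed (rule F)
  then have ex: "\<exists>G. D k G" for k
    by (induction k) (use step in blast)+
  show ?thesis
    unfolding bastiani_smooth_def
  proof (intro conjI allI ballI)
    fix k :: nat and x hs assume x: "x \<in> ?T" and hs: "hs \<in> PiE {..<Suc k} (\<lambda>_. ?T)"
    from hs have "\<forall>i<Suc k. hs i \<in> ?T" by (auto simp: PiE_iff)
    then show "\<exists>l. limitin (silva_top m)
        (\<lambda>t. ser_scale (inverse t) (?d k (x + sv t (hs k)) hs - ?d k x hs)) l (at 0)"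
      using ex[of k] step[of k] x by blast
  next
    fix k :: nat
    let ?P = "prod_topology X (product_topology (\<lambda>_. X) {..<k})"
    have topP: "topspace ?P = ?T \<times> PiE {..<k} (\<lambda>_. ?T)" by simp
    obtain G where G: "hol m (?J k) G"
      "\<And>x hs. x \<in> ?T \<Longrightarrow> \<forall>i<k. hs i \<in> ?T \<Longrightarrow> ?d k x hs = G (enc x hs)"
      using ex[of k] unfolding D_def by blast
    have GLC: "G (enc x hs) \<in> LC m" if "x \<in> ?T" "\<forall>i<k. hs i \<in> ?T" for x hs
      by (rule hol_LC[OF G(1)]) (use enc_LC[OF that] in auto)
    have "continuous_map ?P (silva_top m) (\<lambda>(x, hs). ?d k x hs)"
      unfolding continuous_map_def
    proof (intro conjI allI impI)
      show "(\<lambda>(x, hs). ?d k x hs) \<in> topspace ?P \<rightarrow> topspace (silva_top m)"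
        using G(2) GLC by (auto simp: PiE_iff)
      fix U :: "complex ser set" assume U: "openin (silva_top m) U"
      show "openin ?P {p \<in> topspace ?P. (case p of (x, hs) \<Rightarrow> ?d k x hs) \<in> U}"
      proof (subst openin_subopen, intro ballI)
        fix p assume p: "p \<in> {p \<in> topspace ?P. (case p of (x, hs) \<Rightarrow> ?d k x hs) \<in> U}"
        obtain x hs where [simp]: "p = (x, hs)" by (cases p)
        have x: "x \<in> ?T" and hsE: "hs \<in> PiE {..<k} (\<lambda>_. ?T)" and dU: "?d k x hs \<in> U"
          using p by auto
        from hsE have hs: "\<forall>i<k. hs i \<in> ?T" by (auto simp: PiE_iff)
        have GU: "G (enc x hs) \<in> U" using dU G(2)[OF x hs] by simp
        \<comment> \<open>One \<open>V\<close> serves the base point and all k directions; a finite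
          product of interiors then lies in the preimage.\<close>
        have "\<exists>V. silva_nbhd0 m V \<and> (\<forall>y. (\<forall>a\<in>?J k. y a - enc x hs a \<in> V) \<longrightarrow> G y \<in> U)"
        proof (rule hol_continuous[OF G(1) _ enc_LC[OF x hs] U GU])
          fix V assume "silva_nbhd0 m V" "\<And>y. (\<And>a. a \<in> ?J k \<Longrightarrow> y a - enc x hs a \<in> V) \<Longrightarrow> G y \<in> U"
          then show ?thesis by blast
        qed simp
        then obtain V where V: "silva_nbhd0 m V"
          "\<And>y. (\<And>a. a \<in> ?J k \<Longrightarrow> y a - enc x hs a \<in> V) \<Longrightarrow> G y \<in> U"
          by blast
        obtain U0 where U0: "openin X U0" "x \<in> U0" "\<And>y j. y \<in> U0 \<Longrightarrow> j < r \<Longrightarrow> coord j y - coord j x \<in> V"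
          using nbhd[OF x V(1)] by blast
        have "\<forall>i\<in>{..<k}. \<exists>W. openin X W \<and> hs i \<in> W \<and> (\<forall>y\<in>W. \<forall>j<r. coord j y - coord j (hs i) \<in> V)"
          using nbhd[OF _ V(1)] hs by blast
        from bchoice[OF this] obtain W where
          W: "\<And>i. i < k \<Longrightarrow> openin X (W i)" "\<And>i. i < k \<Longrightarrow> hs i \<in> W i"
             "\<And>i y j. i < k \<Longrightarrow> y \<in> W i \<Longrightarrow> j < r \<Longrightarrow> coord j y - coord j (hs i) \<in> V" by blast
        have "openin ?P (U0 \<times> PiE {..<k} W)"
          using U0 W by (auto simp: openin_prod_Times_iff openin_PiE_gen)
        moreover have "p \<in> U0 \<times> PiE {..<k} W" using U0 W hsE by (auto simp: PiE_iff)
        moreover have "U0 \<times> PiE {..<k} W \<subseteq> {p \<in> topspace ?P. (case p of (x, hs) \<Rightarrow> ?d k x hs) \<in> U}"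
        proof clarify
          fix y gs assume y: "y \<in> U0" and gsE: "gs \<in> PiE {..<k} W"
          have yT: "y \<in> ?T" using y U0(1) openin_subset by blast
          have gs: "\<forall>i<k. gs i \<in> W i" using gsE by (auto simp: PiE_iff)
          then have gsT: "\<forall>i<k. gs i \<in> ?T" using W(1) openin_subset by blast
          have "G (enc y gs) \<in> U"
            by (rule V(2)) (use U0(3) W(3) y gs in \<open>auto simp: enc_def split: nat.splits\<close>)
          then have "?d k y gs \<in> U" using G(2)[OF yT gsT] by simp
          moreover have "gs \<in> PiE {..<k} (\<lambda>_. ?T)" using gsE gsT by (auto simp: PiE_iff)
          ultimately show "(y, gs) \<in> topspace ?P \<and> ?d k y gs \<in> U" using yT by simp
        qed
        ultimately show "\<exists>T. openin ?P T \<and> p \<in> T \<and>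
            T \<subseteq> {p \<in> topspace ?P. (case p of (x, hs) \<Rightarrow> ?d k x hs) \<in> U}" by blast
      qed
    qed
    then show "continuous_map (subtopology ?P (?T \<times> PiE {..<k} (\<lambda>_. ?T))) (silva_top m)
        (\<lambda>(x, hs). ?d k x hs)"
      using continuous_map_from_subtopology by blast
  qed simp
qed

section \<open>Product and inverse as maps with polynomial coefficients\<close>

lemma polyfun_shuffle:
  assumes "\<And>\<eta>. polyfun J (\<lambda>z. u z \<eta>)" "\<And>\<eta>. polyfun J (\<lambda>z. v z \<eta>)"
  shows "polyfun J (\<lambda>z. shuffle (u z) (v z) \<nu>)"
  unfolding shuffle_def case_prod_unfold
  by (intro polyfun_sum polyfun_mult polyfun_const assms)

lemma polyfun_phi:
  assumes "\<And>\<eta> i. polyfun J (\<lambda>z. D z \<eta> i)"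
  shows "polyfun J (\<lambda>z. phi (D z) \<eta> one_ser \<nu>)"
proof (induction \<eta> arbitrary: \<nu>)
  case Nil
  show ?case by (simp add: polyfun_const)
next
  case (Cons i \<eta>)
  show ?case
  proof (cases \<nu>)
    case Nil
    then show ?thesis by (simp add: phi1_Nil polyfun_const)
  next
    case (Cons j \<nu>')
    show ?thesis
      unfolding Cons phi.simps phi1_Cons
      by (intro polyfun_add)
         (cases "j = i"; cases "i \<noteq> 0 \<and> j = 0";
          auto intro: polyfun_const polyfun_shuffle assms Cons.IH)+
  qed
qed

lemma polyfun_scomp:
  assumes "\<And>\<eta> i. polyfun J (\<lambda>z. D z \<eta> i)" "\<And>\<eta>. polyfun J (\<lambda>z. C z \<eta>)"
  shows "polyfun J (\<lambda>z. scomp m (D z) (C z) \<nu>)"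
  unfolding scomp_def by (intro polyfun_sum polyfun_mult polyfun_phi assms)

lemma hol_gmult:
  assumes "a \<in> J" "b \<in> J"
  shows "hol m J (\<lambda>z. gmult m (z a) (z b))"
  unfolding hol_def
proof (intro conjI allI impI)
  show "polyfun J (\<lambda>z. gmult m (z a) (z b) \<eta> i)" for \<eta> i
    unfolding gmult_def mixed_comp_eq plus_fun_apply
    by (intro polyfun_add polyfun_scomp polyfun_coefficient assms)
  fix K :: real assume "1 \<le> K"
  then show "\<exists>K'\<ge>1. \<forall>z. (\<forall>a\<in>J. z a \<in> sball m K) \<longrightarrow> gmult m (z a) (z b) \<in> sball m K'"
    using gmult_sball bound_ge_1 assms by (intro exI[of _ "2 * K * (1 + real m * K)"]) blast
qed

text \<open>Each coefficient of the inverse results from finitely many iterations, all of them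
  polynomial.\<close>

lemma hol_ginv:
  assumes "a \<in> J"
  shows "hol m J (\<lambda>z. ginv m (z a))"
  unfolding hol_def
proof (intro conjI allI impI)
  have "polyfun J (\<lambda>z. inv_approx m (z a) n \<eta> i)" for n \<eta> i
  proof (induction n arbitrary: \<eta> i)
    case (Suc n)
    show ?case
      unfolding inv_approx.simps mixed_comp_eq fun_Compl_def
      by (intro polyfun_uminus polyfun_scomp Suc.IH polyfun_coefficient assms)
  qed (simp add: polyfun_const)
  then show "polyfun J (\<lambda>z. ginv m (z a) \<eta> i)" for \<eta> i unfolding ginv_def by blast
  fix K :: real assume "1 \<le> K"
  then show "\<exists>K'\<ge>1. \<forall>z. (\<forall>a\<in>J. z a \<in> sball m K) \<longrightarrow> ginv m (z a) \<in> sball m K'"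
    using ginv_sball bound_ge_1 assms by (intro exI[of _ "2 * K * (1 + real m * K)"]) blast
qed

lemma complex_analytic_gmult:
  "complex_analytic_B pair_scale ser_scale (prod_topology (silva_top m) (silva_top m)) (silva_top m)
     (LC m \<times> LC m) (\<lambda>(c, d). gmult m c d)"
proof -
  let ?X = "prod_topology (silva_top m) (silva_top m) :: (complex ser \<times> complex ser) topology"
  \<comment> \<open>Every index other than 0 means the second component, which keeps the linearity
    condition true for all \<open>j\<close>.\<close>
  let ?coord = "\<lambda>j (x :: complex ser \<times> complex ser). if j = (0::nat) then fst x else snd x"
  have "bastiani_smooth pair_scale ser_scale ?X (silva_top m) (topspace ?X) (\<lambda>(c, d). gmult m c d)"
  proof (rule bastiani_smooth_hol[where r = 2 and coord = ?coord
        and F = "\<lambda>z. gmult m (z (0, 0)) (z (1, 0))"])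
    show "x \<in> topspace ?X \<longleftrightarrow> (\<forall>j<2. ?coord j x \<in> LC m)" for x
      by (cases x) (auto simp: less_2_cases_iff)
    show "?coord j (x + pair_scale t h) = ?coord j x + ser_scale t (?coord j h)" for j x h t
      by (simp add: pair_scale_def)
    show "hol m ({..<2::nat} \<times> {..0::nat}) (\<lambda>z. gmult m (z (0, 0)) (z (1, 0)))"
      by (rule hol_gmult) auto
    fix x and V :: "complex ser set" assume x: "x \<in> topspace ?X" and V: "silva_nbhd0 m V"
    then have "fst x \<in> LC m" "snd x \<in> LC m" by auto
    then obtain U1 U2 where U1: "openin (silva_top m) U1" "fst x \<in> U1" "\<And>y. y \<in> U1 \<Longrightarrow> y - fst x \<in> V"
      and U2: "openin (silva_top m) U2" "snd x \<in> U2" "\<And>y. y \<in> U2 \<Longrightarrow> y - snd x \<in> V"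
      using silva_nbhd_interior[OF _ V] by metis
    show "\<exists>U. openin ?X U \<and> x \<in> U \<and> (\<forall>y\<in>U. \<forall>j<2. ?coord j y - ?coord j x \<in> V)"
      using U1 U2 by (intro exI[of _ "U1 \<times> U2"]) (auto simp: openin_prod_Times_iff mem_Times_iff)
  qed (auto split: prod.splits)
  then show ?thesis by (simp add: complex_analytic_B_def)
qed

lemma complex_analytic_inverse:
  "complex_analytic_B ser_scale ser_scale (silva_top m) (silva_top m) (LC m) (m_inv (Fliess_group m))"
proof -
  have "bastiani_smooth ser_scale ser_scale (silva_top m) (silva_top m)
     (topspace (silva_top m)) (m_inv (Fliess_group m :: complex ser monoid))"
  proof (rule bastiani_smooth_hol[where r = 1 and coord = "\<lambda>_ x. x" and F = "\<lambda>z. ginv m (z (0, 0))"])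
    show "hol m ({..<1::nat} \<times> {..0::nat}) (\<lambda>z. ginv m (z (0, 0)))" by (rule hol_ginv) auto
    fix x :: "complex ser" and V :: "complex ser set" assume "x \<in> topspace (silva_top m)" "silva_nbhd0 m V"
    then show "\<exists>U. openin (silva_top m) U \<and> x \<in> U \<and> (\<forall>y\<in>U. \<forall>j<1::nat. y - x \<in> V)"
      using silva_nbhd_interior[of x m V] by (metis topspace_silva)
  qed (auto simp: m_inv_Fliess)
  then show ?thesis by (simp add: complex_analytic_B_def)
qed

section \<open>Passage from real to complex series\<close>

lemma shuffle_cplx:
  "shuffle (\<lambda>\<eta>. cplx d \<eta> i) (\<lambda>\<eta>. complex_of_real (e \<eta>)) \<nu> = complex_of_real (shuffle (\<lambda>\<eta>. d \<eta> i) e \<nu>)"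
  by (simp add: shuffle_def case_prod_unfold cplx_def)

lemma phi_cplx: "phi (cplx d) \<eta> one_ser = (\<lambda>\<nu>. complex_of_real (phi d \<eta> one_ser \<nu>))"
proof (induction \<eta>)
  case (Cons i \<eta>)
  show ?case
  proof
    fix \<nu>
    show "phi (cplx d) (i # \<eta>) one_ser \<nu> = complex_of_real (phi d (i # \<eta>) one_ser \<nu>)"
      by (cases \<nu>) (simp_all add: phi1_Nil phi1_Cons Cons.IH shuffle_cplx)
  qed
qed (auto simp: one_ser_def)

text \<open>The product is formed by sums and products with natural number constants, so the complex
  product extends the real one.\<close>

lemma gmult_cplx: "gmult m (cplx c) (cplx d) = cplx (gmult m c d)"
proof (intro ext)
  fix \<nu> k
  show "gmult m (cplx c) (cplx d) \<nu> k = cplx (gmult m c d) \<nu> k"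
    unfolding gmult_def mixed_comp_def plus_fun_apply phi_cplx by (simp add: cplx_def)
qed

lemma cplx_LC: "c \<in> LC m \<Longrightarrow> cplx c \<in> LC m"
  by (auto simp: LC_def wf_ser_def bounded_M_def cplx_def)

text \<open>\<open>cplx\<close> preserves products and the neutral element, so uniqueness of
  inverses in the complex group suffices.\<close>

lemma m_inv_cplx:
  assumes "c \<in> LC m"
  shows "m_inv (Fliess_group m) (cplx c) = cplx (m_inv (Fliess_group m) c)"
proof (rule group.inv_equality[OF group_Fliess])
  have "gmult m (cplx (ginv m c)) (cplx c) = cplx 0"
    by (simp only: gmult_cplx ginv_gmult[OF assms])
  also have "cplx 0 = 0" by (simp add: cplx_def fun_eq_iff)
  finally show "cplx (m_inv (Fliess_group m) c) \<otimes>\<^bsub>Fliess_group m\<^esub> cplx c = \<one>\<^bsub>Fliess_group m\<^esub>"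
    using assms by (simp add: Fliess_group_def m_inv_Fliess[unfolded Fliess_group_def])
qed (use assms in \<open>simp_all add: m_inv_Fliess cplx_LC ginv_LC Fliess_group_def[THEN arg_cong[of _ _ carrier]]\<close>)

lemma openin_LC: "openin (silva_top m) (LC m)"
  using openin_topspace[of "silva_top m"] by simp

lemma openin_LC_Times: "openin (prod_topology (silva_top m) (silva_top m)) (LC m \<times> LC m)"
  by (simp add: openin_prod_Times_iff openin_LC)

theorem theorem5p1:
  shows "(\<forall>m. real_analytic_Lie_group m) \<and> (\<forall>m. complex_analytic_Lie_group m)"
proof (intro conjI allI)
  fix m
  show "complex_analytic_Lie_group m"
    unfolding complex_analytic_Lie_group_def
    using group_Fliess complex_analytic_gmult complex_analytic_inverse by blast
  show "real_analytic_Lie_group m"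
    unfolding real_analytic_Lie_group_def real_analytic_B_def
  proof (intro conjI group_Fliess openin_LC openin_LC_Times)
    show "(\<lambda>(c, d). gmult m c d) ` (LC m \<times> LC m) \<subseteq> topspace (silva_top m)"
      by (auto simp: gmult_LC)
    show "m_inv (Fliess_group m) ` LC m \<subseteq> topspace (silva_top m)"
      by (auto simp: m_inv_Fliess ginv_LC)
    show "\<exists>V g. openin (prod_topology (silva_top m) (silva_top m)) V \<and>
        (\<lambda>(c, d). (cplx c, cplx d)) ` (LC m \<times> LC m) \<subseteq> V \<and>
        complex_analytic_B pair_scale ser_scale (prod_topology (silva_top m) (silva_top m))
          (silva_top m) V g \<and>
        (\<forall>x\<in>LC m \<times> LC m. g (case x of (c, d) \<Rightarrow> (cplx c, cplx d)) =
           cplx (case x of (c, d) \<Rightarrow> gmult m c d))"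
      \<comment> \<open>The extension is global: the complex product, defined on the whole
        complexification.\<close>
      using openin_LC_Times complex_analytic_gmult
      by (intro exI[of _ "LC m \<times> LC m"] exI[of _ "\<lambda>(c, d). gmult m c d"])
         (auto simp: cplx_LC gmult_cplx)
    show "\<exists>V g. openin (silva_top m) V \<and> cplx ` LC m \<subseteq> V \<and>
        complex_analytic_B ser_scale ser_scale (silva_top m) (silva_top m) V g \<and>
        (\<forall>x\<in>LC m. g (cplx x) = cplx (m_inv (Fliess_group m) x))"
      using openin_LC complex_analytic_inverse
      by (intro exI[of _ "LC m"] exI[of _ "m_inv (Fliess_group m)"])
         (auto simp: cplx_LC m_inv_cplx)
  qed
qed

end
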